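(* Let $L\ge\ln n$ be such that $\rho=O(L)$. Suppose that $\ln(1/\varepsilon)=O(L)$. Then the infeasible inexact potential reduction algorithm (defined in the context) terminates in $O(\nu(n+\nu)^2L)$ iterations, provided that $\kappa$ is chosen independently of $n$. If the algorithm stops in step 1, then the iterate is an $\varepsilon$-approximate solution; otherwise it stops in step 3, showing that there are no optimal solutions $x^*$ to the primal problem and $(y^*,z^* )$ to the dual problem such that $\|(x^*,z^* )\|_\infty\le\rho$.
   Context: Let $A\in\mathbb{R}^{m\times n}$ have full row rank, $b\in\mathbb{R}^m$, $c\in\mathbb{R}^n$. The linear programs are: minimize $c^Tx$ subject to $Ax=b,\ x\ge0$ (primal), and maximize $b^Ty$ subject to $A^Ty+z=c,\ z\ge0$ (dual). $\|\cdot\|$ is the Euclidean norm and $e$ is the $n$-vector of ones; vector inequalities are componentwise. Potential function: for $x,z>0$ in $\mathbb{R}^n$, $\phi(x,z)=(n+\nu)\ln(x^Tz)-\sum_{i=1}^n\ln(x_iz_i)-n\ln n$. Scaled inexact Newton system at $(x^k,y^k,z^k)$ with $x^k,z^k>0$ and parameter $\mu>0$: let $X^k=\mathrm{diag}(x^k)$, $Z^k=\mathrm{diag}(z^k)$, $D=(X^k)^{1/2}(Z^k)^{-1/2}$, $W=(X^kZ^k)^{1/2}$, $w=We$, and $p=b-Ax^k$, $q=D(c-A^Ty^k-z^k)$, $r=-w+\mu W^{-1}e$. The inexact solution $(\Delta u,\Delta y,\Delta v)$ with residual $\xi\in\mathbb{R}^n$ is the solution of $$AD\,\Delta u=p,\qquad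 DA^T\Delta y+\Delta v=q,\qquad \Delta u+\Delta v=r+\xi .$$ Infeasible inexact potential reduction algorithm. Given $\rho>0$ and $\varepsilon>0$. Set $(x^0,y^0,z^0)=\rho(e,0,e)$. Choose $\sqrt n\le\nu\le2n$ and $\kappa\in[0,1)$. Set $\delta=(1-\kappa)^4/(1600(n+\nu)^2)$ and $k=0$. 1. If $(x^k)^Tz^k\le\varepsilon$ then stop. 2. Let $\mu=(x^k)^Tz^k/(n+\nu)$. Compute the solution of the scaled inexact Newton system with residual $\xi$ that satisfies (a) $-r^T\xi\le\kappa\|r\|^2$, (b) $\|\xi\|\le\kappa\min(\|\Delta u\|,\|\Delta v\|)$, (c) $-w^T\xi\le\kappa\frac{n}{n+\nu}\|w\|^2$. Set $\Delta x=D\Delta u$, $\Delta z=D^{-1}\Delta v$. 3. Find a step size $\alpha^k$ such that $\phi(x^k+\alpha^k\Delta x,z^k+\alpha^k\Delta z)\le\phi(x^k,z^k)-\delta$ and $(x^k+\alpha^k\Delta x)^T(z^k+\alpha^k\Delta z)\ge(1-\alpha^k)(x^k)^Tz^k$. If no such step size exists then stop. 4. Set $(x^{k+1},y^{k+1},z^{k+1})=(x^k,y^k,z^k)+\alpha^k(\Delta x,\Delta y,\Delta z)$, $k:=k+1$, and go to 1. Step sizes are always chosen to keep the iterates $x^k$ and $z^k$ positive. Terminology: that the iterate $(x^k,y^k,z^k)$ is an $\varepsilon$-approximate solution means that $(x^k)^Tz^k\le\varepsilon$ and $\|(Ax^k-b,\ A^Ty^k+z^k-c)\|\le\varepsilon\,\|(Ax^0-b,\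 A^Ty^0+z^0-c)\|/\big((x^0)^Tz^0\big)$.
   Formalization: Step sizes are required to lie in (0,1]; with a step size above 1 the test against (1−α)xᵀz is void, and the algorithm can stop in step 1 at an iterate that is not an ε-approximate solution. *)

theory Defs
  imports "Jordan_Normal_Form.DL_Rank"
begin

text \<open>
  The complexity bound is uniform over all dimensions, so vectors and matrices are those of
  Jordan-Normal-Form, whose dimensions are ordinary natural numbers. The number n of variables
  is the number of columns of A, the number m of constraints its number of rows.
\<close>

type_synonym rvec = "real vec"
type_synonym rmat = "real mat"

definition eucl_norm :: "rvec \<Rightarrow> real" where
  "eucl_norm v = sqrt (v \<bullet> v)"

text \<open>The inserted 0 only matters for the vector of dimension 0.\<close>

definition max_norm :: "rvec \<Rightarrow> real" where
  "max_norm v = Max (insert 0 {\<bar>v $ i\<bar> | i. i < dim_vec v})"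

definition ones :: "nat \<Rightarrow> rvec" where
  "ones n = vec n (\<lambda>_. 1)"

text \<open>
  The library order \<open>\<le>\<close> on vectors is componentwise, but its strict part \<open><\<close> is not;
  componentwise positivity is therefore spelled out.
\<close>

definition positive_vec :: "rvec \<Rightarrow> bool" where
  "positive_vec v \<longleftrightarrow> (\<forall>i < dim_vec v. 0 < v $ i)"


subsection \<open>The linear programs\<close>

definition primal_feasible :: "rmat \<Rightarrow> rvec \<Rightarrow> rvec \<Rightarrow> bool" where
  "primal_feasible A b x \<longleftrightarrow>
     x \<in> carrier_vec (dim_col A) \<and> A *\<^sub>v x = b \<and> 0\<^sub>v (dim_col A) \<le> x"

definition primal_optimal :: "rmat \<Rightarrow> rvec \<Rightarrow> rvec \<Rightarrow> rvec \<Rightarrow> bool" where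
  "primal_optimal A b c x \<longleftrightarrow>
     primal_feasible A b x \<and> (\<forall>x'. primal_feasible A b x' \<longrightarrow> c \<bullet> x \<le> c \<bullet> x')"

definition dual_feasible :: "rmat \<Rightarrow> rvec \<Rightarrow> rvec \<Rightarrow> rvec \<Rightarrow> bool" where
  "dual_feasible A c y z \<longleftrightarrow>
     y \<in> carrier_vec (dim_row A) \<and> z \<in> carrier_vec (dim_col A) \<and>
     transpose_mat A *\<^sub>v y + z = c \<and> 0\<^sub>v (dim_col A) \<le> z"

definition dual_optimal :: "rmat \<Rightarrow> rvec \<Rightarrow> rvec \<Rightarrow> rvec \<Rightarrow> rvec \<Rightarrow> bool" where
  "dual_optimal A b c y z \<longleftrightarrow>
     dual_feasible A c y z \<and> (\<forall>y' z'. dual_feasible A c y' z' \<longrightarrow> b \<bullet> y' \<le> b \<bullet> y)"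


subsection \<open>The scaled inexact Newton system\<close>

definition potential :: "real \<Rightarrow> rvec \<Rightarrow> rvec \<Rightarrow> real" where
  "potential \<nu> x z = (let n = dim_vec x in
     (real n + \<nu>) * ln (x \<bullet> z) - (\<Sum>i<n. ln (x $ i * z $ i)) - real n * ln (real n))"

definition scal_D :: "rvec \<Rightarrow> rvec \<Rightarrow> rmat" where
  "scal_D x z = mat_diag (dim_vec x) (\<lambda>i. sqrt (x $ i) / sqrt (z $ i))"

definition scal_D_inv :: "rvec \<Rightarrow> rvec \<Rightarrow> rmat" where
  "scal_D_inv x z = mat_diag (dim_vec x) (\<lambda>i. sqrt (z $ i) / sqrt (x $ i))"

definition scal_W :: "rvec \<Rightarrow> rvec \<Rightarrow> rmat" where
  "scal_W x z = mat_diag (dim_vec x) (\<lambda>i. sqrt (x $ i * z $ i))"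

definition scal_W_inv :: "rvec \<Rightarrow> rvec \<Rightarrow> rmat" where
  "scal_W_inv x z = mat_diag (dim_vec x) (\<lambda>i. 1 / sqrt (x $ i * z $ i))"

definition vec_w :: "rvec \<Rightarrow> rvec \<Rightarrow> rvec" where
  "vec_w x z = scal_W x z *\<^sub>v ones (dim_vec x)"

definition vec_p :: "rmat \<Rightarrow> rvec \<Rightarrow> rvec \<Rightarrow> rvec" where
  "vec_p A b x = b - A *\<^sub>v x"

definition vec_q :: "rmat \<Rightarrow> rvec \<Rightarrow> rvec \<Rightarrow> rvec \<Rightarrow> rvec \<Rightarrow> rvec" where
  "vec_q A c x y z = scal_D x z *\<^sub>v (c - transpose_mat A *\<^sub>v y - z)"

definition vec_r :: "real \<Rightarrow> rvec \<Rightarrow> rvec \<Rightarrow> rvec" where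
  "vec_r \<mu> x z = - vec_w x z + \<mu> \<cdot>\<^sub>v (scal_W_inv x z *\<^sub>v ones (dim_vec x))"

definition newton_solution ::
  "rmat \<Rightarrow> rvec \<Rightarrow> rvec \<Rightarrow> real \<Rightarrow> rvec \<Rightarrow> rvec \<Rightarrow> rvec \<Rightarrow> rvec \<Rightarrow> rvec \<Rightarrow> rvec \<Rightarrow> rvec \<Rightarrow> bool" where
  "newton_solution A b c \<mu> x y z \<xi> du dy dv \<longleftrightarrow>
     du \<in> carrier_vec (dim_col A) \<and> dy \<in> carrier_vec (dim_row A) \<and> dv \<in> carrier_vec (dim_col A) \<and>
     (A * scal_D x z) *\<^sub>v du = vec_p A b x \<and>
     (scal_D x z * transpose_mat A) *\<^sub>v dy + dv = vec_q A c x y z \<and>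
     du + dv = vec_r \<mu> x z + \<xi>"


subsection \<open>The infeasible inexact potential reduction algorithm\<close>

text \<open>The directions \<open>(\<Delta>x, \<Delta>y, \<Delta>z)\<close> that step 2 may produce at \<open>(x, y, z)\<close>.\<close>

definition search_direction ::
  "rmat \<Rightarrow> rvec \<Rightarrow> rvec \<Rightarrow> real \<Rightarrow> real \<Rightarrow> rvec \<Rightarrow> rvec \<Rightarrow> rvec \<Rightarrow> rvec \<Rightarrow> rvec \<Rightarrow> rvec \<Rightarrow> bool" where
  "search_direction A b c \<nu> \<kappa> x y z dx dy dz \<longleftrightarrow>
     (let n = dim_col A; \<mu> = (x \<bullet> z) / (real n + \<nu>); w = vec_w x z; r = vec_r \<mu> x z in
      \<exists>\<xi> du dv. \<xi> \<in> carrier_vec n \<and>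
        newton_solution A b c \<mu> x y z \<xi> du dy dv \<and>
        - (r \<bullet> \<xi>) \<le> \<kappa> * (eucl_norm r)\<^sup>2 \<and>
        eucl_norm \<xi> \<le> \<kappa> * min (eucl_norm du) (eucl_norm dv) \<and>
        - (w \<bullet> \<xi>) \<le> \<kappa> * (real n / (real n + \<nu>)) * (eucl_norm w)\<^sup>2 \<and>
        dx = scal_D x z *\<^sub>v du \<and> dz = scal_D_inv x z *\<^sub>v dv)"

text \<open>
  Step sizes are at most 1, since \<open>1 - \<alpha>\<close> is the factor by which the infeasibility is reduced
  and that the last condition compares with the decrease of the complementarity gap.
\<close>

definition step_size :: "real \<Rightarrow> real \<Rightarrow> rvec \<Rightarrow> rvec \<Rightarrow> rvec \<Rightarrow> rvec \<Rightarrow> real \<Rightarrow> bool" where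
  "step_size \<nu> \<kappa> x z dx dz \<alpha> \<longleftrightarrow>
     (let n = dim_vec x; \<delta> = (1 - \<kappa>)^4 / (1600 * (real n + \<nu>)\<^sup>2);
          x' = x + \<alpha> \<cdot>\<^sub>v dx; z' = z + \<alpha> \<cdot>\<^sub>v dz in
      0 < \<alpha> \<and> \<alpha> \<le> 1 \<and> positive_vec x' \<and> positive_vec z' \<and>
      potential \<nu> x' z' \<le> potential \<nu> x z - \<delta> \<and>
      x' \<bullet> z' \<ge> (1 - \<alpha>) * (x \<bullet> z))"

text \<open>
  Control states: about to execute step 1 with iteration counter \<open>k\<close>; about to execute step 3
  with a computed direction; stopped in step 1; stopped in step 3.
\<close>

datatype config =
    AtStep1 nat rvec rvec rvec
  | AtStep3 nat rvec rvec rvec rvec rvec rvec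
  | StoppedInStep1 nat rvec rvec rvec
  | StoppedInStep3 nat rvec rvec rvec

inductive transition ::
  "rmat \<Rightarrow> rvec \<Rightarrow> rvec \<Rightarrow> real \<Rightarrow> real \<Rightarrow> real \<Rightarrow> config \<Rightarrow> config \<Rightarrow> bool"
  for A b c \<epsilon> \<nu> \<kappa> where
  stop1: "x \<bullet> z \<le> \<epsilon> \<Longrightarrow>
     transition A b c \<epsilon> \<nu> \<kappa> (AtStep1 k x y z) (StoppedInStep1 k x y z)"
| direction: "\<not> x \<bullet> z \<le> \<epsilon> \<Longrightarrow> search_direction A b c \<nu> \<kappa> x y z dx dy dz \<Longrightarrow>
     transition A b c \<epsilon> \<nu> \<kappa> (AtStep1 k x y z) (AtStep3 k x y z dx dy dz)"
| stop3: "\<nexists>\<alpha>. step_size \<nu> \<kappa> x z dx dz \<alpha> \<Longrightarrow>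
     transition A b c \<epsilon> \<nu> \<kappa> (AtStep3 k x y z dx dy dz) (StoppedInStep3 k x y z)"
| update: "step_size \<nu> \<kappa> x z dx dz \<alpha> \<Longrightarrow>
     transition A b c \<epsilon> \<nu> \<kappa> (AtStep3 k x y z dx dy dz)
       (AtStep1 (Suc k) (x + \<alpha> \<cdot>\<^sub>v dx) (y + \<alpha> \<cdot>\<^sub>v dy) (z + \<alpha> \<cdot>\<^sub>v dz))"

definition initial_x :: "rmat \<Rightarrow> real \<Rightarrow> rvec" where
  "initial_x A \<rho> = \<rho> \<cdot>\<^sub>v ones (dim_col A)"

definition initial_y :: "rmat \<Rightarrow> rvec" where
  "initial_y A = 0\<^sub>v (dim_row A)"

definition initial_z :: "rmat \<Rightarrow> real \<Rightarrow> rvec" where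
  "initial_z A \<rho> = \<rho> \<cdot>\<^sub>v ones (dim_col A)"

text \<open>
  A complete run, for an arbitrary resolution of the choices of residual and step size. It stays
  put only in a configuration without successor, so runs always exist, and a run that got stuck
  without reaching one of the two stopping configurations would be a legitimate run.
\<close>

definition complete_run ::
  "rmat \<Rightarrow> rvec \<Rightarrow> rvec \<Rightarrow> real \<Rightarrow> real \<Rightarrow> real \<Rightarrow> real \<Rightarrow> (nat \<Rightarrow> config) \<Rightarrow> bool" where
  "complete_run A b c \<rho> \<epsilon> \<nu> \<kappa> s \<longleftrightarrow>
     s 0 = AtStep1 0 (initial_x A \<rho>) (initial_y A) (initial_z A \<rho>) \<and>
     (\<forall>t. transition A b c \<epsilon> \<nu> \<kappa> (s t) (s (Suc t)) \<or>
          (s (Suc t) = s t \<and> (\<nexists>s'. transition A b c \<epsilon> \<nu> \<kappa> (s t) s')))"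

definition residual_norm :: "rmat \<Rightarrow> rvec \<Rightarrow> rvec \<Rightarrow> rvec \<Rightarrow> rvec \<Rightarrow> rvec \<Rightarrow> real" where
  "residual_norm A b c x y z =
     eucl_norm ((A *\<^sub>v x - b) @\<^sub>v (transpose_mat A *\<^sub>v y + z - c))"

definition approximate_solution ::
  "rmat \<Rightarrow> rvec \<Rightarrow> rvec \<Rightarrow> real \<Rightarrow> real \<Rightarrow> rvec \<Rightarrow> rvec \<Rightarrow> rvec \<Rightarrow> bool" where
  "approximate_solution A b c \<rho> \<epsilon> x y z \<longleftrightarrow>
     x \<bullet> z \<le> \<epsilon> \<and>
     residual_norm A b c x y z
       \<le> \<epsilon> * residual_norm A b c (initial_x A \<rho>) (initial_y A) (initial_z A \<rho>)
           / (initial_x A \<rho> \<bullet> initial_z A \<rho>)"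

end

theory Submission
  imports Defs "HOL-Analysis.L2_Norm"
begin

text \<open>
  A step of length \<open>\<alpha>\<close> multiplies both infeasibilities by \<open>1 - \<alpha>\<close>, so the iterates have residuals
  \<open>\<theta>\<close> times the initial ones, with \<open>x \<bullet> z \<ge> \<theta> (x\<^sup>0 \<bullet> z\<^sup>0)\<close>; this gives the accuracy of an iterate with small
  gap. By the inequality of arithmetic and geometric means the potential is at least \<open>\<nu> ln (x \<bullet> z)\<close>,
  so a decrease by \<open>\<delta>\<close> per iteration bounds the number of iterations.

  If optimal solutions bounded by \<open>\<rho>\<close> exist, they are complementary, and comparing an iterate with
  \<open>\<theta> (x\<^sup>0, z\<^sup>0) + (1 - \<theta>) (x*, z*)\<close> bounds its scaled distance to the feasible set by
  \<open>2 (x \<bullet> z) / min w\<close>. As the scaled primal and dual directions are orthogonal up to that distance,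
  both have length at most \<open>3 (n + \<nu>) \<parallel>r\<parallel> / (1 - \<kappa>)\<close>. Together with
  \<open>\<parallel>r\<parallel> min w \<ge> (\<surd>3 / 2) \<mu>\<close> this shows that the step
  \<open>\<alpha> = (1 - \<kappa>) min w / (20 B\<^sup>2 \<parallel>r\<parallel>)\<close> with \<open>B = 3 (n + \<nu>) / (1 - \<kappa>)\<close> is
  acceptable, hence the algorithm cannot stop in step 3.
\<close>


subsection \<open>The central path residual\<close>

text \<open>Optimality is defined by comparing objective values, so the complementarity of an
  optimal pair has to be earned: it comes from strong duality, derived here from Farkas' lemma. Full
  row rank has another task: it makes the exact Newton system solvable, and a solution with
  \<open>\<xi> = 0\<close> is an admissible direction, so no run gets stuck in step 1. One iteration
  is analysed for real functions on finite index sets: a step changes \<open>x\<close> and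
  \<open>z\<close> by the relative amounts \<open>\<alpha> * u i / w i\<close> and
  \<open>\<alpha> * v i / w i\<close>, which the smallest \<open>w i\<close> controls; hence
  \<open>min w\<close> in the step size. The last obstacle is the uniform constant: the potential
  bounds only \<open>k - 1\<close>, and for \<open>n = 1\<close> the hypothesis
  \<open>ln n \<le> L\<close> does not keep \<open>L\<close> away from 0, so the remaining 1 is not
  obviously a multiple of \<open>L\<close>.\<close>

lemma L2_set_power2: "(L2_set f A)\<^sup>2 = (\<Sum>i\<in>A. (f i)\<^sup>2)"
  by (simp add: L2_set_def sum_nonneg)

lemma L2_set_uminus: "L2_set (\<lambda>i. - f i) A = L2_set f A"
  by (simp add: L2_set_def)

lemma abs_sum_mult_le_L2_set: "\<bar>\<Sum>i\<in>A. f i * g i\<bar> \<le> L2_set f A * L2_set g A"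
proof -
  have "\<bar>\<Sum>i\<in>A. f i * g i\<bar> \<le> (\<Sum>i\<in>A. \<bar>f i * g i\<bar>)"
    by (rule sum_abs)
  also have "\<dots> \<le> L2_set f A * L2_set g A"
    using L2_set_mult_ineq[of f g A] by (simp add: abs_mult)
  finally show ?thesis .
qed

lemma L2_set_diff_triangle: "L2_set (\<lambda>i. f i - g i) A \<le> L2_set f A + L2_set g A"
  using L2_set_triangle_ineq[of f "\<lambda>i. - g i" A] by (simp add: L2_set_uminus)

text \<open>
  The orthogonal vectors \<open>u + f\<close> and \<open>v + g\<close> have sum and difference of equal length, and
  \<open>2 u = ((u + f) - (v + g)) + (u + v + g - f)\<close>.
\<close>
lemma L2_set_le_if_orthogonal:
  assumes orth: "(\<Sum>i\<in>A. (u i + f i) * (v i + g i)) = 0"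
  shows "L2_set u A \<le> L2_set (\<lambda>i. u i + v i) A + L2_set f A + L2_set g A"
proof -
  let ?s = "\<lambda>i. u i + v i"
  have eq: "L2_set (\<lambda>i. (u i + f i) - (v i + g i)) A = L2_set (\<lambda>i. (u i + f i) + (v i + g i)) A"
  proof -
    have "(\<Sum>i\<in>A. ((u i + f i) + (v i + g i))\<^sup>2) - (\<Sum>i\<in>A. ((u i + f i) - (v i + g i))\<^sup>2)
        = (\<Sum>i\<in>A. 4 * ((u i + f i) * (v i + g i)))"
      unfolding sum_subtractf[symmetric]
      by (rule sum.cong[OF refl]) (simp add: power2_eq_square algebra_simps)
    also have "\<dots> = 0"
      using orth by (simp only: sum_distrib_left[symmetric])
    finally show ?thesis by (simp add: L2_set_def)
  qed
  have t1: "L2_set (\<lambda>i. ?s i + g i) A \<le> L2_set ?s A + L2_set g A"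
    by (rule L2_set_triangle_ineq)
  have t2: "L2_set (\<lambda>i. (?s i + g i) + f i) A \<le> L2_set (\<lambda>i. ?s i + g i) A + L2_set f A"
    by (rule L2_set_triangle_ineq)
  have t3: "L2_set (\<lambda>i. (?s i + g i) - f i) A \<le> L2_set (\<lambda>i. ?s i + g i) A + L2_set f A"
    by (rule L2_set_diff_triangle)
  have "2 * L2_set u A = L2_set (\<lambda>i. ((u i + f i) - (v i + g i)) + ((?s i + g i) - f i)) A"
    by (simp add: L2_set_right_distrib)
  also have "\<dots> \<le> L2_set (\<lambda>i. (u i + f i) - (v i + g i)) A + L2_set (\<lambda>i. (?s i + g i) - f i) A"
    by (rule L2_set_triangle_ineq)
  also have "L2_set (\<lambda>i. (u i + f i) - (v i + g i)) A = L2_set (\<lambda>i. (?s i + g i) + f i) A"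
    unfolding eq by (simp add: algebra_simps)
  finally show ?thesis using t1 t2 t3 by linarith
qed

text \<open>\<open>w\<close> abstracts the square roots of \<open>x $ i * z $ i\<close>:
  \<open>gap\<close> is then the scalar product of \<open>x\<close> and \<open>z\<close>, and
  \<open>r\<close> is the vector of the Newton system.\<close>

locale scaled_point =
  fixes I :: "'i set" and w :: "'i \<Rightarrow> real" and \<nu> :: real
  assumes finite_I: "finite I" and nonempty_I: "I \<noteq> {}"
    and w_pos: "\<And>i. i \<in> I \<Longrightarrow> 0 < w i"
    and nu_lower: "sqrt (card I) \<le> \<nu>" and nu_upper: "\<nu> \<le> 2 * card I"
begin

definition "n = real (card I)"
definition "gap = (\<Sum>i\<in>I. (w i)\<^sup>2)"
definition "\<mu> = gap / (n + \<nu>)"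
definition "r i = - w i + \<mu> / w i"
definition "wmin = Min (w ` I)"
definition "R = L2_set r I"

lemma n_ge_1: "1 \<le> n"
  unfolding n_def using finite_I nonempty_I by (simp add: Suc_leI card_gt_0_iff)

lemma nu_ge_1: "1 \<le> \<nu>"
proof -
  have "1 \<le> sqrt n" using n_ge_1 real_sqrt_le_mono[of 1 n] by (simp only: real_sqrt_one)
  then show ?thesis using nu_lower unfolding n_def by linarith
qed

lemma nu_power2: "n \<le> \<nu>\<^sup>2"
  using nu_lower real_le_lsqrt[of n \<nu>] n_ge_1 nu_ge_1
  by (metis n_def of_nat_0_le_iff real_sqrt_le_iff real_sqrt_pow2 power_mono real_sqrt_ge_zero)

lemma gap_pos: "0 < gap"
  unfolding gap_def using finite_I nonempty_I w_pos by (intro sum_pos zero_less_power) simp_all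

lemma gap_eq: "gap = \<mu> * (n + \<nu>)"
  using n_ge_1 nu_ge_1 by (simp add: \<mu>_def)

lemma mu_pos: "0 < \<mu>"
  using gap_pos n_ge_1 nu_ge_1 by (simp add: \<mu>_def)

lemma wmin_le: "i \<in> I \<Longrightarrow> wmin \<le> w i"
  unfolding wmin_def using finite_I by simp

lemma wmin_attained: "\<exists>j\<in>I. wmin = w j"
  using Min_in[of "w ` I"] finite_I nonempty_I unfolding wmin_def by (simp add: image_iff)

lemma wmin_pos: "0 < wmin"
  using wmin_attained w_pos by auto

lemma wmin_power2_le: "n * wmin\<^sup>2 \<le> gap"
proof -
  have "n * wmin\<^sup>2 = (\<Sum>i\<in>I. wmin\<^sup>2)" by (simp add: n_def)
  also have "\<dots> \<le> gap" unfolding gap_def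
    using wmin_le wmin_pos by (intro sum_mono power_mono) (auto simp: less_imp_le)
  finally show ?thesis .
qed

text \<open>The smallest square is at most the mean \<open>gap / n\<close>, and
  \<open>gap = \<mu> * (n + \<nu>)\<close> with \<open>\<nu> \<le> 2 * n\<close>.\<close>

lemma wmin_power2_le_mu: "wmin\<^sup>2 \<le> 3 * \<mu>"
proof -
  have "n * wmin\<^sup>2 \<le> \<mu> * (n + \<nu>)" using wmin_power2_le gap_eq by simp
  also have "\<dots> \<le> \<mu> * (3 * n)" using mu_pos nu_upper by (intro mult_left_mono) (auto simp: n_def)
  finally have "n * wmin\<^sup>2 \<le> n * (3 * \<mu>)" by (simp add: algebra_simps)
  then show ?thesis using n_ge_1 by simp
qed

lemma R_power2: "R\<^sup>2 = \<mu>\<^sup>2 * (\<Sum>i\<in>I. 1 / (w i)\<^sup>2) - 2 * n * \<mu> + gap"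
proof -
  have "R\<^sup>2 = (\<Sum>i\<in>I. (r i)\<^sup>2)" by (simp add: R_def L2_set_power2)
  also have "\<dots> = (\<Sum>i\<in>I. \<mu>\<^sup>2 * (1 / (w i)\<^sup>2) - 2 * \<mu> + (w i)\<^sup>2)"
  proof (rule sum.cong[OF refl])
    fix i assume "i \<in> I"
    then have "w i \<noteq> 0" using w_pos by force
    then show "(r i)\<^sup>2 = \<mu>\<^sup>2 * (1 / (w i)\<^sup>2) - 2 * \<mu> + (w i)\<^sup>2"
      by (simp add: r_def power2_eq_square field_simps)
  qed
  also have "\<dots> = \<mu>\<^sup>2 * (\<Sum>i\<in>I. 1 / (w i)\<^sup>2) - 2 * n * \<mu> + gap"
    by (simp add: sum.distrib sum_subtractf sum_distrib_left gap_def n_def)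
  finally show ?thesis .
qed

text \<open>
  \<open>r / \<mu>\<close> is the sum of the orthogonal vectors \<open>1 / w - (n / gap) w\<close> and \<open>- (\<nu> / gap) w\<close>;
  the constant is a rational lower bound for \<open>\<surd>3 / 2\<close>.
\<close>
lemma R_wmin_lower: "86 / 100 * \<mu> \<le> R * wmin"
proof -
  obtain j where j: "j \<in> I" "wmin = w j" using wmin_attained by auto
  \<comment> \<open>The smallest \<open>(w i)\<^sup>2\<close> relative to the mean of these
    squares.\<close>
  define s where "s = n * wmin\<^sup>2 / gap"
  have S: "(\<Sum>i\<in>I. (1 / w i - n / gap * w i)\<^sup>2) = (\<Sum>i\<in>I. 1 / (w i)\<^sup>2) - n\<^sup>2 / gap"
  proof -
    have "(\<Sum>i\<in>I. (1 / w i - n / gap * w i)\<^sup>2)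
        = (\<Sum>i\<in>I. 1 / (w i)\<^sup>2 - 2 * (n / gap) + (n / gap)\<^sup>2 * (w i)\<^sup>2)"
    proof (rule sum.cong[OF refl])
      fix i assume "i \<in> I"
      then have "w i \<noteq> 0" using w_pos by force
      then show "(1 / w i - n / gap * w i)\<^sup>2 = 1 / (w i)\<^sup>2 - 2 * (n / gap) + (n / gap)\<^sup>2 * (w i)\<^sup>2"
        using gap_pos by (simp add: power2_eq_square field_simps)
    qed
    also have "\<dots> = (\<Sum>i\<in>I. 1 / (w i)\<^sup>2) - n * (2 * (n / gap)) + (n / gap)\<^sup>2 * gap"
      by (simp add: sum.distrib sum_subtractf sum_distrib_left gap_def n_def)
    also have "\<dots> = (\<Sum>i\<in>I. 1 / (w i)\<^sup>2) - n\<^sup>2 / gap"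
      using gap_pos by (simp add: power2_eq_square field_simps)
    finally show ?thesis .
  qed
  \<comment> \<open>Only the summand of the minimiser \<open>j\<close> is kept.\<close>
  have "(1 / wmin - n / gap * wmin)\<^sup>2 \<le> (\<Sum>i\<in>I. (1 / w i - n / gap * w i)\<^sup>2)"
    unfolding j(2) using j(1) finite_I
      member_le_sum[of j I "\<lambda>i. (1 / w i - n / gap * w i)\<^sup>2"] by auto
  then have lower: "(1 / wmin - n / gap * wmin)\<^sup>2 + n\<^sup>2 / gap \<le> (\<Sum>i\<in>I. 1 / (w i)\<^sup>2)"
    using S by simp
  have "(1 - s)\<^sup>2 = wmin\<^sup>2 * (1 / wmin - n / gap * wmin)\<^sup>2"
    using wmin_pos gap_pos by (simp add: s_def power2_eq_square field_simps)
  then have a: "(1 - s)\<^sup>2 + wmin\<^sup>2 * (n\<^sup>2 / gap) \<le> wmin\<^sup>2 * (\<Sum>i\<in>I. 1 / (w i)\<^sup>2)"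
    using mult_left_mono[OF lower, of "wmin\<^sup>2"] by (simp add: algebra_simps)
  \<comment> \<open>Both sides are \<open>\<mu> * (\<nu> - n)\<close>; the right-hand form shares
    the factor \<open>\<mu>\<^sup>2\<close> with the first term of \<open>R_power2\<close>.\<close>
  have g: "gap - 2 * n * \<mu> = \<mu>\<^sup>2 * ((\<nu>\<^sup>2 - n\<^sup>2) / gap)"
  proof -
    have "\<mu>\<^sup>2 * ((\<nu>\<^sup>2 - n\<^sup>2) / gap) = \<mu> * (\<nu> - n)"
    proof -
      have "(\<nu>\<^sup>2 - n\<^sup>2) = (\<nu> + n) * (\<nu> - n)" by (simp add: power2_eq_square algebra_simps)
      moreover have "n + \<nu> \<noteq> 0" using n_ge_1 nu_ge_1 by simp
      ultimately show ?thesis using mu_pos unfolding gap_eq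
        by (simp add: power2_eq_square add.commute)
    qed
    then show ?thesis by (simp add: gap_eq algebra_simps)
  qed
  have "wmin\<^sup>2 * R\<^sup>2 = \<mu>\<^sup>2 * (wmin\<^sup>2 * (\<Sum>i\<in>I. 1 / (w i)\<^sup>2) + wmin\<^sup>2 * ((\<nu>\<^sup>2 - n\<^sup>2) / gap))"
  proof -
    define S T where "S = (\<Sum>i\<in>I. 1 / (w i)\<^sup>2)" and "T = (\<nu>\<^sup>2 - n\<^sup>2) / gap"
    have "R\<^sup>2 = \<mu>\<^sup>2 * S + \<mu>\<^sup>2 * T"
      using R_power2 g unfolding S_def[symmetric] T_def[symmetric] by linarith
    then show ?thesis unfolding S_def[symmetric] T_def[symmetric] by (simp add: algebra_simps)
  qed
  also have "\<dots> \<ge> \<mu>\<^sup>2 * (3 / 4)"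
  proof (rule mult_left_mono)
    have "s \<le> wmin\<^sup>2 * (\<nu>\<^sup>2 / gap)"
      using nu_power2 gap_pos mult_left_mono[of n "\<nu>\<^sup>2" "wmin\<^sup>2"]
      by (simp add: s_def divide_right_mono mult.commute)
    moreover have "wmin\<^sup>2 * ((\<nu>\<^sup>2 - n\<^sup>2) / gap) = wmin\<^sup>2 * (\<nu>\<^sup>2 / gap) - wmin\<^sup>2 * (n\<^sup>2 / gap)"
      by (simp only: diff_divide_distrib right_diff_distrib)
    \<comment> \<open>Equality holds at \<open>s = 1 / 2\<close>. The summand \<open>s\<close> comes
      from the component along \<open>w\<close>, by \<open>n \<le> \<nu>\<^sup>2\<close>.\<close>
    moreover have "3 / 4 \<le> (1 - s)\<^sup>2 + s"
      using zero_le_power2[of "s - 1 / 2"] by (simp add: power2_eq_square algebra_simps)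
    ultimately show "3 / 4 \<le> wmin\<^sup>2 * (\<Sum>i\<in>I. 1 / (w i)\<^sup>2) + wmin\<^sup>2 * ((\<nu>\<^sup>2 - n\<^sup>2) / gap)"
      using a by linarith
  qed simp
  finally have "\<mu>\<^sup>2 * (3 / 4) \<le> (R * wmin)\<^sup>2" by (simp add: power_mult_distrib mult.commute)
  moreover have "(86 / 100 * \<mu>)\<^sup>2 \<le> \<mu>\<^sup>2 * (3 / 4)"
    by (simp add: power_mult_distrib power2_eq_square)
  ultimately have "(86 / 100 * \<mu>)\<^sup>2 \<le> (R * wmin)\<^sup>2" by linarith
  moreover have "0 \<le> R * wmin" using wmin_pos by (simp add: R_def)
  ultimately show ?thesis by (rule power2_le_imp_le)
qed

lemma R_pos: "0 < R"
proof -
  have "0 < R * wmin" using R_wmin_lower mu_pos by linarith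
  then show ?thesis using wmin_pos by (rule zero_less_mult_pos2)
qed

text \<open>Replacing each \<open>w i\<close> by \<open>wmin\<close> in the reciprocal squares of
  \<open>R_power2\<close> bounds the square of the product by \<open>4 * n * \<mu>\<^sup>2\<close>.
  In \<open>new_gap_lower\<close> this makes the second-order term comparable with
  \<open>n * \<mu>\<close>.\<close>

lemma R_wmin_upper: "R * wmin \<le> 2 * n * \<mu>"
proof -
  have nn: "n \<le> n\<^sup>2" using n_ge_1 by (simp add: power2_eq_square)
  have "(\<Sum>i\<in>I. 1 / (w i)\<^sup>2) \<le> (\<Sum>i\<in>I. 1 / wmin\<^sup>2)"
    proof (rule sum_mono)
    fix i assume i: "i \<in> I"
    have "wmin\<^sup>2 \<le> (w i)\<^sup>2"
      using wmin_le[OF i] wmin_pos by (intro power_mono) auto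
    then show "1 / (w i)\<^sup>2 \<le> 1 / wmin\<^sup>2"
      using wmin_pos by (intro divide_left_mono mult_pos_pos zero_less_power w_pos i) auto
  qed
  also have "\<dots> = n / wmin\<^sup>2" by (simp add: n_def)
  finally have a: "wmin\<^sup>2 * (\<Sum>i\<in>I. 1 / (w i)\<^sup>2) \<le> n"
    using wmin_pos by (simp add: pos_le_divide_eq mult.commute)
  have gap: "gap - 2 * n * \<mu> \<le> n * \<mu>"
  proof -
    have "gap \<le> \<mu> * (3 * n)"
      unfolding gap_eq using mu_pos nu_upper by (intro mult_left_mono) (auto simp: n_def)
    then show ?thesis by (simp add: mult_ac)
  qed
  have b: "wmin\<^sup>2 * (gap - 2 * n * \<mu>) \<le> (3 * \<mu>) * (n * \<mu>)"
  proof -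
    have "wmin\<^sup>2 * (gap - 2 * n * \<mu>) \<le> wmin\<^sup>2 * (n * \<mu>)"
      using gap by (rule mult_left_mono) simp
    also have "\<dots> \<le> (3 * \<mu>) * (n * \<mu>)"
      using wmin_power2_le_mu by (rule mult_right_mono) (use mu_pos n_ge_1 in simp)
    finally show ?thesis .
  qed
  have "(R * wmin)\<^sup>2 = wmin\<^sup>2 * (\<mu>\<^sup>2 * (\<Sum>i\<in>I. 1 / (w i)\<^sup>2) + (gap - 2 * n * \<mu>))"
    by (simp add: power_mult_distrib R_power2)
  also have "\<dots> = \<mu>\<^sup>2 * (wmin\<^sup>2 * (\<Sum>i\<in>I. 1 / (w i)\<^sup>2)) + wmin\<^sup>2 * (gap - 2 * n * \<mu>)"
    unfolding distrib_left by (simp only: mult.left_commute)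
  also have "\<dots> \<le> \<mu>\<^sup>2 * n + (3 * \<mu>) * (n * \<mu>)"
    by (rule add_mono[OF mult_left_mono[OF a] b]) simp
  also have "\<dots> = n * (4 * \<mu>\<^sup>2)" by (simp add: power2_eq_square)
  also have "\<dots> \<le> n\<^sup>2 * (4 * \<mu>\<^sup>2)" using nn by (rule mult_right_mono) simp
  also have "\<dots> = (2 * n * \<mu>)\<^sup>2" by (simp add: power_mult_distrib)
  finally show ?thesis by (rule power2_le_imp_le) (use n_ge_1 mu_pos in simp)
qed

end


subsection \<open>Decrease of the potential\<close>

text \<open>The length bounds on \<open>u\<close> and \<open>v\<close> are assumed here;
  \<open>newton_direction_bound\<close> supplies them when a bounded optimal pair exists. The two
  conditions on \<open>\<xi>\<close> are (a) and (c) of step 2; condition (b) is spent on the length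
  bounds.\<close>

locale scaled_direction = scaled_point +
  fixes \<kappa> :: real and u v \<xi> :: "'a \<Rightarrow> real"
  assumes kappa_nonneg: "0 \<le> \<kappa>" and kappa_less_1: "\<kappa> < 1"
    and u_add_v: "\<And>i. i \<in> I \<Longrightarrow> u i + v i = r i + \<xi> i"
    and r_xi: "- (\<Sum>i\<in>I. r i * \<xi> i) \<le> \<kappa> * R\<^sup>2"
    and w_xi: "- (\<Sum>i\<in>I. w i * \<xi> i) \<le> \<kappa> * (n / (n + \<nu>)) * gap"
    and u_le: "L2_set u I \<le> 3 * (n + \<nu>) / (1 - \<kappa>) * R"
    and v_le: "L2_set v I \<le> 3 * (n + \<nu>) / (1 - \<kappa>) * R"
begin

definition "B = 3 * (n + \<nu>) / (1 - \<kappa>)"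
text \<open>The 20 is chosen so that the second-order losses of the potential,
  \<open>7 * \<gamma>\<^sup>2 * B\<^sup>2\<close> in total, stay well below the first-order gain
  \<open>86 / 100 * (1 - \<kappa>) * \<gamma>\<close>.\<close>

definition "\<gamma> = (1 - \<kappa>) / (20 * B\<^sup>2)"
definition "\<alpha> = \<gamma> * wmin / R"
text \<open>The scalar product of the new \<open>x\<close> and \<open>z\<close>: the two factors are
  the relative changes of \<open>x\<close> and \<open>z\<close> in component \<open>i\<close>, and
  \<open>(w i)\<^sup>2\<close> is the old product.\<close>

definition "new_gap = (\<Sum>i\<in>I. (w i)\<^sup>2 * ((1 + \<alpha> * u i / w i) * (1 + \<alpha> * v i / w i)))"

lemma B_ge_6: "6 \<le> B"
proof -
  have "6 \<le> 3 * (n + \<nu>) / 1" using n_ge_1 nu_ge_1 by simp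
  also have "\<dots> \<le> B" unfolding B_def
    using n_ge_1 nu_ge_1 kappa_nonneg kappa_less_1 by (intro divide_left_mono) auto
  finally show ?thesis .
qed

lemma gamma_pos: "0 < \<gamma>"
  using B_ge_6 kappa_less_1 by (simp add: \<gamma>_def)

lemma gamma_B_power2: "\<gamma> * B\<^sup>2 = (1 - \<kappa>) / 20"
  using B_ge_6 by (simp add: \<gamma>_def)

lemma gamma_B_le: "\<gamma> * B \<le> 1 / 120"
proof -
  have "6 * (\<gamma> * B) \<le> \<gamma> * B\<^sup>2"
    using B_ge_6 gamma_pos mult_right_mono[of 6 B "\<gamma> * B"] by (simp add: power2_eq_square mult_ac)
  then show ?thesis using gamma_B_power2 kappa_nonneg by simp
qed

lemma alpha_pos: "0 < \<alpha>"
  using gamma_pos wmin_pos R_pos by (simp add: \<alpha>_def)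

lemma alpha_R: "\<alpha> * R = \<gamma> * wmin"
  using R_pos by (simp add: \<alpha>_def)

text \<open>The bounds on \<open>wmin\<^sup>2\<close> and \<open>R * wmin\<close> in terms of
  \<open>\<mu>\<close> make \<open>wmin\<close> a small multiple of \<open>R\<close>, while
  \<open>B \<ge> 6\<close> gives \<open>\<gamma> \<le> 1 / 720\<close>; the crude
  \<open>wmin \<le> 720 * R\<close> is enough.\<close>

lemma alpha_le_1: "\<alpha> \<le> 1"
proof -
  have "36 * \<gamma> \<le> \<gamma> * B\<^sup>2"
    using mult_right_mono[of 36 "B\<^sup>2" \<gamma>] power_mono[OF B_ge_6, of 2] gamma_pos by (simp add: mult_ac)
  then have g: "\<gamma> \<le> 1 / 720" using gamma_B_power2 kappa_nonneg by simp
  have "86 / 100 * (wmin * wmin) \<le> 86 / 100 * (3 * \<mu>)"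
    using wmin_power2_le_mu by (simp add: power2_eq_square)
  also have "\<dots> \<le> 3 * R * wmin" using R_wmin_lower by (simp add: mult.commute)
  finally have "86 / 100 * wmin \<le> 3 * R"
    using wmin_pos by (simp add: mult.assoc[symmetric])
  then have "wmin \<le> 720 * R" using R_pos by simp
  then have "\<gamma> * wmin \<le> 1 / 720 * (720 * R)"
    using g gamma_pos wmin_pos R_pos by (intro mult_mono) auto
  then show ?thesis using R_pos by (simp add: \<alpha>_def)
qed

text \<open>Dividing by \<open>w i\<close> costs at most a factor \<open>1 / wmin\<close>, which the
  factor \<open>wmin / R\<close> of \<open>\<alpha>\<close> cancels; Euclidean length at most
  \<open>\<gamma> * B\<close> remains.\<close>

lemma relative_change:
  assumes "L2_set h I \<le> B * R"
  shows "i \<in> I \<Longrightarrow> \<bar>\<alpha> * h i / w i\<bar> \<le> 1 / 2"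
    and "(\<Sum>i\<in>I. (\<alpha> * h i / w i)\<^sup>2) \<le> \<gamma>\<^sup>2 * B\<^sup>2"
proof -
  have le: "(\<alpha> * h i / w i)\<^sup>2 \<le> (\<alpha> / wmin)\<^sup>2 * (h i)\<^sup>2" if "i \<in> I" for i
  proof -
    have "(\<alpha> * h i / w i)\<^sup>2 = \<alpha>\<^sup>2 * (h i)\<^sup>2 / (w i)\<^sup>2" by (simp add: power_divide power_mult_distrib)
    also have "\<dots> \<le> \<alpha>\<^sup>2 * (h i)\<^sup>2 / wmin\<^sup>2"
      using wmin_le[OF that] wmin_pos by (intro divide_left_mono power_mono mult_pos_pos) auto
    finally show ?thesis by (simp add: power_divide)
  qed
  have "(\<Sum>i\<in>I. (\<alpha> * h i / w i)\<^sup>2) \<le> (\<alpha> / wmin)\<^sup>2 * (L2_set h I)\<^sup>2"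
    using le by (simp add: L2_set_power2 sum_distrib_left sum_mono)
  also have "\<dots> \<le> (\<alpha> / wmin)\<^sup>2 * (B * R)\<^sup>2"
    using assms by (intro mult_left_mono power_mono) auto
  also have "\<dots> = (\<alpha> * R / wmin)\<^sup>2 * B\<^sup>2" by (simp add: power_mult_distrib power_divide)
  also have "\<dots> = \<gamma>\<^sup>2 * B\<^sup>2" using wmin_pos by (simp add: alpha_R)
  finally show *: "(\<Sum>i\<in>I. (\<alpha> * h i / w i)\<^sup>2) \<le> \<gamma>\<^sup>2 * B\<^sup>2" .
  assume i: "i \<in> I"
  have "(\<alpha> * h i / w i)\<^sup>2 \<le> (\<Sum>i\<in>I. (\<alpha> * h i / w i)\<^sup>2)"
    using i finite_I member_le_sum[of i I "\<lambda>i. (\<alpha> * h i / w i)\<^sup>2"] by simp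
  also have "\<dots> \<le> (\<gamma> * B)\<^sup>2" using * by (simp add: power_mult_distrib)
  finally have "\<bar>\<alpha> * h i / w i\<bar> \<le> \<bar>\<gamma> * B\<bar>" by (simp only: abs_le_square_iff)
  also have "\<dots> \<le> 1 / 2" using gamma_B_le gamma_pos B_ge_6 by simp
  finally show "\<bar>\<alpha> * h i / w i\<bar> \<le> 1 / 2" .
qed

lemmas u_change = relative_change[OF u_le[folded B_def]]
lemmas v_change = relative_change[OF v_le[folded B_def]]

lemma factors_pos:
  assumes "i \<in> I"
  shows "0 < 1 + \<alpha> * u i / w i" and "0 < 1 + \<alpha> * v i / w i"
  using u_change(1)[OF assms] v_change(1)[OF assms] by linarith+

lemma new_gap_eq:
  "new_gap = gap + \<alpha> * (\<Sum>i\<in>I. w i * (r i + \<xi> i)) + \<alpha>\<^sup>2 * (\<Sum>i\<in>I. u i * v i)"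
proof -
  have "new_gap = (\<Sum>i\<in>I. (w i)\<^sup>2 + \<alpha> * (w i * (r i + \<xi> i)) + \<alpha>\<^sup>2 * (u i * v i))"
    unfolding new_gap_def
  proof (rule sum.cong[OF refl])
    fix i assume i: "i \<in> I"
    have "w i \<noteq> 0" using w_pos[OF i] by simp
    then have "(w i)\<^sup>2 * ((1 + \<alpha> * u i / w i) * (1 + \<alpha> * v i / w i))
        = (w i + \<alpha> * u i) * (w i + \<alpha> * v i)"
      by (simp add: power2_eq_square field_simps)
    also have "\<dots> = (w i)\<^sup>2 + \<alpha> * (w i * (u i + v i)) + \<alpha>\<^sup>2 * (u i * v i)"
      by (simp add: power2_eq_square algebra_simps)
    finally show "(w i)\<^sup>2 * ((1 + \<alpha> * u i / w i) * (1 + \<alpha> * v i / w i))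
        = (w i)\<^sup>2 + \<alpha> * (w i * (r i + \<xi> i)) + \<alpha>\<^sup>2 * (u i * v i)"
      using u_add_v[OF i] by simp
  qed
  then show ?thesis by (simp add: sum.distrib sum_distrib_left gap_def)
qed

lemma second_order: "\<bar>\<alpha>\<^sup>2 * (\<Sum>i\<in>I. u i * v i)\<bar> \<le> (\<gamma> * B * wmin)\<^sup>2"
proof -
  have "\<bar>\<Sum>i\<in>I. u i * v i\<bar> \<le> L2_set u I * L2_set v I" by (rule abs_sum_mult_le_L2_set)
  also have "\<dots> \<le> (B * R) * (B * R)"
    using u_le[folded B_def] v_le[folded B_def] R_pos B_ge_6 by (intro mult_mono) auto
  finally have "\<alpha>\<^sup>2 * \<bar>\<Sum>i\<in>I. u i * v i\<bar> \<le> \<alpha>\<^sup>2 * (B * R * (B * R))"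
    by (rule mult_left_mono) simp
  also have "\<dots> = (B * (\<alpha> * R))\<^sup>2" by (simp add: power2_eq_square)
  also have "\<dots> = (\<gamma> * B * wmin)\<^sup>2" unfolding alpha_R by (simp add: mult_ac)
  finally show ?thesis by (simp add: abs_mult)
qed

lemma w_r: "(\<Sum>i\<in>I. w i * r i) = - gap + n * \<mu>"
proof -
  have "(\<Sum>i\<in>I. w i * r i) = (\<Sum>i\<in>I. - (w i)\<^sup>2 + \<mu>)"
  proof (rule sum.cong[OF refl])
    fix i assume "i \<in> I"
    then have "w i \<noteq> 0" using w_pos by force
    then show "w i * r i = - (w i)\<^sup>2 + \<mu>" by (simp add: r_def power2_eq_square field_simps)
  qed
  then show ?thesis by (simp add: sum_subtractf gap_def n_def)
qed

text \<open>To first order the gap changes by \<open>- \<alpha> * gap + \<alpha> * n * \<mu>\<close>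
  and a contribution of \<open>\<xi>\<close>. Condition (c) leaves at least the fraction
  \<open>1 - \<kappa>\<close> of the second summand, and a tenth of that covers the second-order
  term.\<close>

lemma new_gap_lower: "(1 - \<alpha>) * gap \<le> new_gap"
proof -
  have xi: "- (\<Sum>i\<in>I. w i * \<xi> i) \<le> \<kappa> * (n * \<mu>)"
    using w_xi by (simp add: \<mu>_def)
  have "(\<gamma> * B * wmin)\<^sup>2 = \<gamma> * B\<^sup>2 * (\<gamma> * wmin) * wmin" by (simp add: power2_eq_square)
  also have "\<dots> = (1 - \<kappa>) / 20 * \<alpha> * (R * wmin)" by (simp add: gamma_B_power2 flip: alpha_R)
  also have "\<dots> \<le> (1 - \<kappa>) / 20 * \<alpha> * (2 * n * \<mu>)"
    using R_wmin_upper kappa_less_1 alpha_pos by (intro mult_left_mono) auto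
  also have "\<dots> = \<alpha> * ((1 - \<kappa>) * (n * \<mu>)) / 10" by simp
  also have "\<dots> \<le> \<alpha> * ((1 - \<kappa>) * (n * \<mu>))"
    using kappa_less_1 alpha_pos n_ge_1 mu_pos by simp
  finally have q: "- (\<alpha>\<^sup>2 * (\<Sum>i\<in>I. u i * v i)) \<le> \<alpha> * ((1 - \<kappa>) * (n * \<mu>))"
    using second_order by linarith
  have "(\<Sum>i\<in>I. w i * (r i + \<xi> i)) = - gap + n * \<mu> + (\<Sum>i\<in>I. w i * \<xi> i)"
    by (simp add: distrib_left sum.distrib w_r)
  also have "\<dots> \<ge> - gap + (1 - \<kappa>) * (n * \<mu>)" using xi by (simp add: algebra_simps)
  finally have "\<alpha> * (- gap + (1 - \<kappa>) * (n * \<mu>)) \<le> \<alpha> * (\<Sum>i\<in>I. w i * (r i + \<xi> i))"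
    using alpha_pos by simp
  then show ?thesis using q by (simp add: new_gap_eq algebra_simps)
qed

lemma new_gap_pos: "0 < new_gap"
  unfolding new_gap_def using finite_I nonempty_I factors_pos w_pos
  by (intro sum_pos mult_pos_pos zero_less_power) auto

lemma sum_ln_lower:
  assumes "\<And>i. i \<in> I \<Longrightarrow> \<bar>h i\<bar> \<le> 1 / 2"
  shows "(\<Sum>i\<in>I. h i) - 2 * (\<Sum>i\<in>I. (h i)\<^sup>2) \<le> (\<Sum>i\<in>I. ln (1 + h i :: real))"
proof -
  have "(\<Sum>i\<in>I. h i) - 2 * (\<Sum>i\<in>I. (h i)\<^sup>2) = (\<Sum>i\<in>I. h i - 2 * (h i)\<^sup>2)"
    by (simp add: sum_subtractf sum_distrib_left)
  also have "\<dots> \<le> (\<Sum>i\<in>I. ln (1 + h i))"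
  proof (rule sum_mono)
    fix i assume "i \<in> I"
    then have "\<bar>ln (1 + h i) - h i\<bar> \<le> 2 * (h i)\<^sup>2"
      using assms by (intro abs_ln_one_plus_x_minus_x_bound)
    then show "h i - 2 * (h i)\<^sup>2 \<le> ln (1 + h i)" by linarith
  qed
  finally show ?thesis .
qed

text \<open>The logarithms of the old products cancel in the difference of potentials and are left
  out. The first-order terms combine to the scalar product of \<open>r\<close> and
  \<open>r + \<xi>\<close> times \<open>- \<alpha> / \<mu>\<close>, because
  \<open>w i / \<mu> - 1 / w i = - r i / \<mu>\<close>. Condition (a) keeps
  \<open>(1 - \<kappa>) * R\<^sup>2\<close> of it, and \<open>R_wmin_lower\<close> makes the gain a
  multiple of \<open>\<gamma>\<close>.\<close>

lemma potential_decrease: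
  "(n + \<nu>) * ln new_gap - (\<Sum>i\<in>I. ln (1 + \<alpha> * u i / w i)) - (\<Sum>i\<in>I. ln (1 + \<alpha> * v i / w i))
     \<le> (n + \<nu>) * ln gap - (1 - \<kappa>) ^ 4 / (1600 * (n + \<nu>)\<^sup>2)"
proof -
  define S where "S = (\<Sum>i\<in>I. w i * (r i + \<xi> i))"
  define T where "T = (\<Sum>i\<in>I. (r i + \<xi> i) / w i)"
  define Q where "Q = \<alpha>\<^sup>2 * (\<Sum>i\<in>I. u i * v i)"
  have Q: "Q \<le> \<mu> * (3 * \<gamma>\<^sup>2 * B\<^sup>2)"
  proof -
    have "(\<gamma> * B * wmin)\<^sup>2 \<le> (\<gamma> * B)\<^sup>2 * (3 * \<mu>)"
      unfolding power_mult_distrib[of "\<gamma> * B"] using wmin_power2_le_mu by (intro mult_left_mono) auto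
    then show ?thesis using second_order by (simp add: Q_def power_mult_distrib mult_ac)
  qed
  have "ln new_gap - ln gap \<le> new_gap / gap - 1"
    using ln_le_minus_one[of "new_gap / gap"] new_gap_pos gap_pos by (simp add: ln_div)
  also have "\<dots> = (\<alpha> * S + Q) / gap"
    using gap_pos by (simp add: new_gap_eq S_def Q_def field_simps)
  finally have "(n + \<nu>) * (ln new_gap - ln gap) \<le> (n + \<nu>) * ((\<alpha> * S + Q) / gap)"
    using n_ge_1 nu_ge_1 by (intro mult_left_mono) auto
  also have "\<dots> = (\<alpha> * S + Q) / \<mu>" using n_ge_1 nu_ge_1 mu_pos by (simp add: gap_eq)
  also have "\<dots> \<le> \<alpha> * S / \<mu> + 3 * \<gamma>\<^sup>2 * B\<^sup>2"
    using Q mu_pos by (simp add: add_divide_distrib pos_divide_le_eq mult.commute)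
  finally have 1: "(n + \<nu>) * (ln new_gap - ln gap) \<le> \<alpha> * S / \<mu> + 3 * \<gamma>\<^sup>2 * B\<^sup>2" .

  have "(\<Sum>i\<in>I. \<alpha> * u i / w i) + (\<Sum>i\<in>I. \<alpha> * v i / w i) = (\<Sum>i\<in>I. \<alpha> * (u i + v i) / w i)"
    by (simp add: sum.distrib distrib_left add_divide_distrib)
  also have "\<dots> = \<alpha> * T"
    by (simp add: T_def sum_distrib_left u_add_v)
  finally have 2: "\<alpha> * T - 4 * \<gamma>\<^sup>2 * B\<^sup>2
      \<le> (\<Sum>i\<in>I. ln (1 + \<alpha> * u i / w i)) + (\<Sum>i\<in>I. ln (1 + \<alpha> * v i / w i))"
    using sum_ln_lower[of "\<lambda>i. \<alpha> * u i / w i", OF u_change(1)] u_change(2)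
      sum_ln_lower[of "\<lambda>i. \<alpha> * v i / w i", OF v_change(1)] v_change(2) by linarith

  have "S / \<mu> - T = (\<Sum>i\<in>I. - (r i * (r i + \<xi> i) / \<mu>))"
    unfolding S_def T_def sum_divide_distrib sum_subtractf[symmetric]
  proof (rule sum.cong[OF refl])
    fix i assume "i \<in> I"
    then have "w i \<noteq> 0" using w_pos by force
    then have r: "- r i / \<mu> = w i / \<mu> - 1 / w i" using mu_pos by (simp add: r_def field_simps)
    have "w i * (r i + \<xi> i) / \<mu> - (r i + \<xi> i) / w i = (w i / \<mu> - 1 / w i) * (r i + \<xi> i)"
      by (simp only: left_diff_distrib times_divide_eq_left mult_1_left)
    also have "\<dots> = - (r i * (r i + \<xi> i) / \<mu>)" by (simp flip: r)
    finally show "w i * (r i + \<xi> i) / \<mu> - (r i + \<xi> i) / w i = - (r i * (r i + \<xi> i) / \<mu>)" .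
  qed
  also have "\<dots> = - (R\<^sup>2 + (\<Sum>i\<in>I. r i * \<xi> i)) / \<mu>"
  proof -
    have "R\<^sup>2 + (\<Sum>i\<in>I. r i * \<xi> i) = (\<Sum>i\<in>I. r i * (r i + \<xi> i))"
      unfolding R_def L2_set_power2 by (simp add: sum.distrib distrib_left power2_eq_square)
    then show ?thesis by (simp add: sum_negf flip: sum_divide_distrib)
  qed
  also have "\<dots> \<le> - ((1 - \<kappa>) * R\<^sup>2) / \<mu>"
    using r_xi mu_pos by (intro divide_right_mono) (auto simp: algebra_simps)
  finally have "\<alpha> * (S / \<mu> - T) \<le> \<alpha> * (- ((1 - \<kappa>) * R\<^sup>2) / \<mu>)"
    by (rule mult_left_mono) (use alpha_pos in simp)
  also have "\<dots> = - ((1 - \<kappa>) * (\<alpha> * R) * R / \<mu>)" by (simp add: power2_eq_square)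
  also have "\<dots> = - ((1 - \<kappa>) * \<gamma> * (R * wmin / \<mu>))" by (simp add: alpha_R)
  also have "\<dots> \<le> - ((1 - \<kappa>) * \<gamma> * (86 / 100))"
  proof -
    have "86 / 100 \<le> R * wmin / \<mu>" using R_wmin_lower mu_pos by (simp add: pos_le_divide_eq)
    then have "(1 - \<kappa>) * \<gamma> * (86 / 100) \<le> (1 - \<kappa>) * \<gamma> * (R * wmin / \<mu>)"
      by (rule mult_left_mono) (use gamma_pos kappa_less_1 in simp)
    then show ?thesis by (simp only: neg_le_iff_le)
  qed
  finally have 3: "\<alpha> * S / \<mu> - \<alpha> * T \<le> - ((1 - \<kappa>) * \<gamma> * (86 / 100))"
    by (simp add: right_diff_distrib)

  \<comment> \<open>The gap costs 3 of these terms and the two sums of logarithms 2 each, together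
    35/100 of \<open>(1 - \<kappa>) * \<gamma>\<close>; the net decrease is 86/100 - 35/100 =
    51/100.\<close>
  have 4: "\<gamma>\<^sup>2 * B\<^sup>2 = (1 - \<kappa>) * \<gamma> / 20"
    using gamma_B_power2 by (simp add: power2_eq_square)
  \<comment> \<open>Inserting \<open>B\<close> gives
    \<open>\<gamma> = (1 - \<kappa>) ^ 3 / (180 * (n + \<nu>)\<^sup>2)\<close>.\<close>
  have "(1 - \<kappa>) ^ 4 / (1600 * (n + \<nu>)\<^sup>2) = (1 - \<kappa>) * \<gamma> * (180 / 1600)"
  proof -
    define k where "k = 1 - \<kappa>"
    have "0 < k" using kappa_less_1 by (simp add: k_def)
    moreover have "n + \<nu> = B * k / 3" using kappa_less_1 by (simp add: B_def k_def)
    then have "(n + \<nu>)\<^sup>2 = (B * k)\<^sup>2 / 9" by (simp only: power_divide) simp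
    ultimately show ?thesis using B_ge_6 unfolding \<gamma>_def k_def[symmetric]
      by - (simp only:, simp add: power4_eq_xxxx power2_eq_square field_simps)
  qed
  moreover have "0 \<le> (1 - \<kappa>) * \<gamma>" using kappa_less_1 gamma_pos by simp
  ultimately have "(1 - \<kappa>) ^ 4 / (1600 * (n + \<nu>)\<^sup>2) \<le> (1 - \<kappa>) * \<gamma> * (51 / 100)" by simp
  then show ?thesis using 1 2 3 4 by (simp add: right_diff_distrib)
qed

end


subsection \<open>Strong duality\<close>

text \<open>
  Induction on the generators (Bartl): if dropping the generator \<open>k\<close> breaks the hypothesis, a
  witness \<open>x\<close> satisfies \<open>a k \<cdot> x < 0\<close>, and projecting along \<open>x\<close> onto the kernel of \<open>a k\<close>
  preserves the hypothesis for the remaining generators.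
\<close>
lemma farkas:
  fixes a :: "'i \<Rightarrow> 'j \<Rightarrow> real" and g :: "'j \<Rightarrow> real"
  assumes "finite I" and J: "finite J"
    and "\<And>d. (\<And>i. i \<in> I \<Longrightarrow> 0 \<le> (\<Sum>j\<in>J. a i j * d j)) \<Longrightarrow> 0 \<le> (\<Sum>j\<in>J. g j * d j)"
  shows "\<exists>l. (\<forall>i\<in>I. 0 \<le> l i) \<and> (\<forall>j\<in>J. g j = (\<Sum>i\<in>I. l i * a i j))"
  using assms(1,3)
proof (induction I arbitrary: a g rule: finite_induct)
  case empty
  \<comment> \<open>Testing the hypothesis with \<open>- g\<close> forces \<open>g\<close> to vanish
    on \<open>J\<close>.\<close>
  have "(\<Sum>j\<in>J. (g j)\<^sup>2) \<le> 0"
    using empty[of "\<lambda>j. - g j"] by (simp add: power2_eq_square sum_negf)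
  then have "\<forall>j\<in>J. g j = 0"
    using J sum_nonneg_eq_0_iff[of J "\<lambda>j. (g j)\<^sup>2"] sum_nonneg[of J "\<lambda>j. (g j)\<^sup>2"] by simp
  then show ?case by simp
next
  case (insert k F)
  show ?case
  proof (cases "\<forall>d. (\<forall>i\<in>F. 0 \<le> (\<Sum>j\<in>J. a i j * d j)) \<longrightarrow> 0 \<le> (\<Sum>j\<in>J. g j * d j)")
    case True
    then obtain l where l: "\<forall>i\<in>F. 0 \<le> l i" "\<forall>j\<in>J. g j = (\<Sum>i\<in>F. l i * a i j)"
      using insert.IH[of a g] by blast
    have "(\<Sum>i\<in>F. (l(k := 0)) i * a i j) = (\<Sum>i\<in>F. l i * a i j)" for j
      using insert.hyps by (intro sum.cong) auto
    then show ?thesis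
      using l insert.hyps by (intro exI[of _ "l(k := 0)"]) auto
  next
    case False
    have lin1: "(\<Sum>j\<in>J. (s j - q * r j) * d j) = (\<Sum>j\<in>J. s j * d j) - q * (\<Sum>j\<in>J. r j * d j)"
      for q :: real and s r d
      by (simp add: left_diff_distrib sum_subtractf sum_distrib_left mult.assoc)
    have lin2: "(\<Sum>j\<in>J. s j * (d j - q * r j)) = (\<Sum>j\<in>J. s j * d j) - q * (\<Sum>j\<in>J. s j * r j)"
      for q :: real and s r d
      by (simp add: right_diff_distrib sum_subtractf sum_distrib_left mult.left_commute)
    define f where "f i d = (\<Sum>j\<in>J. a i j * d j)" for i d
    define h where "h d = (\<Sum>j\<in>J. g j * d j)" for d
    obtain x where x: "\<And>i. i \<in> F \<Longrightarrow> 0 \<le> f i x" "h x < 0"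
      using False unfolding f_def h_def by force
    define p where "p = f k x"
    \<comment> \<open>Otherwise \<open>x\<close> would meet all constraints of
      \<open>insert k F\<close> and still have \<open>h x < 0\<close>.\<close>
    have p: "p < 0"
      using x insert.prems[of x] unfolding p_def f_def h_def by force
    \<comment> \<open>\<open>a'\<close> and \<open>g'\<close> are \<open>a\<close> and
      \<open>g\<close> composed with the projection \<open>d'\<close> below; \<open>a' k\<close>
      vanishes, so \<open>d'\<close> meets the constraint of \<open>k\<close>.\<close>
    define a' where "a' i j = a i j - f i x / p * a k j" for i j
    define g' where "g' j = g j - h x / p * a k j" for j
    have "\<exists>l. (\<forall>i\<in>F. 0 \<le> l i) \<and> (\<forall>j\<in>J. g' j = (\<Sum>i\<in>F. l i * a' i j))"
    proof (rule insert.IH)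
      fix d assume d: "\<And>i. i \<in> F \<Longrightarrow> 0 \<le> (\<Sum>j\<in>J. a' i j * d j)"
      define d' where "d' j = d j - f k d / p * x j" for j
      have f': "f i d' = (\<Sum>j\<in>J. a' i j * d j)" for i
      proof -
        have "f i d' = f i d - f k d / p * f i x"
          unfolding f_def[of i] d'_def by (rule lin2)
        also have "\<dots> = f i d - f i x / p * f k d" by simp
        also have "\<dots> = (\<Sum>j\<in>J. a' i j * d j)"
          unfolding f_def[of i d] f_def[of k d] a'_def by (rule lin1[symmetric])
        finally show ?thesis .
      qed
      have h': "h d' = (\<Sum>j\<in>J. g' j * d j)"
      proof -
        have "h d' = h d - f k d / p * h x"
          unfolding h_def d'_def by (rule lin2)
        also have "\<dots> = h d - h x / p * f k d" by simp
        also have "\<dots> = (\<Sum>j\<in>J. g' j * d j)"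
          unfolding h_def[of d] f_def[of k d] g'_def by (rule lin1[symmetric])
        finally show ?thesis .
      qed
      have "a' k j = 0" for j using p by (simp add: a'_def p_def)
      then have "0 \<le> f i d'" if "i \<in> insert k F" for i
        using that d f' by auto
      then show "0 \<le> (\<Sum>j\<in>J. g' j * d j)"
        using insert.prems[of d'] h' unfolding f_def h_def by simp
    qed
    then obtain l where l: "\<forall>i\<in>F. 0 \<le> l i" "\<forall>j\<in>J. g' j = (\<Sum>i\<in>F. l i * a' i j)" by blast
    \<comment> \<open>The coefficient of \<open>a k\<close> after undoing the projection; its
      summands are nonnegative by the signs of \<open>h x\<close>, \<open>f i x\<close> and
      \<open>p\<close>.\<close>
    define c where "c = h x / p + (\<Sum>i\<in>F. l i * (- (f i x / p)))"
    have "0 \<le> c"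
      unfolding c_def using x l(1) p
      by (intro add_nonneg_nonneg sum_nonneg mult_nonneg_nonneg)
        (auto simp: divide_nonpos_neg divide_nonneg_neg)
    moreover have "g j = c * a k j + (\<Sum>i\<in>F. l i * a i j)" if "j \<in> J" for j
    proof -
      have "g j = h x / p * a k j + (\<Sum>i\<in>F. l i * a' i j)"
        using l(2) that by (simp add: g'_def algebra_simps)
      also have "(\<Sum>i\<in>F. l i * a' i j)
          = (\<Sum>i\<in>F. l i * a i j) + (\<Sum>i\<in>F. l i * (- (f i x / p))) * a k j"
        unfolding sum_distrib_right sum.distrib[symmetric]
        by (rule sum.cong[OF refl]) (simp add: a'_def right_diff_distrib)
      finally show ?thesis by (simp add: c_def distrib_right)
    qed
    moreover have "(\<Sum>i\<in>F. (l(k := c)) i * a i j) = (\<Sum>i\<in>F. l i * a i j)" for j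
      using insert.hyps by (intro sum.cong) auto
    ultimately show ?thesis
      using l(1) insert.hyps by (intro exI[of _ "l(k := c)"]) auto
  qed
qed

text \<open>Positive components stay nonnegative for small \<open>t\<close> by continuity, zero
  components by the sign of \<open>d j\<close>; finiteness of \<open>J\<close> gives a common
  \<open>t\<close>.\<close>

lemma nonneg_small_step:
  fixes x d :: "'j \<Rightarrow> real"
  assumes "finite J" and "\<And>j. j \<in> J \<Longrightarrow> 0 \<le> x j" and "\<And>j. j \<in> J \<Longrightarrow> x j = 0 \<Longrightarrow> 0 \<le> d j"
  shows "\<exists>t>0. \<forall>j\<in>J. 0 \<le> x j + t * d j"
proof -
  have "\<forall>\<^sub>F t in at_right 0. 0 \<le> x j + t * d j" if j: "j \<in> J" for j
  proof (cases "x j = 0")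
    case True
    show ?thesis
      by (rule eventually_mono[OF eventually_at_right_less[of "0::real"]])
        (use True assms(3)[OF j] in simp)
  next
    case False
    have "((\<lambda>t. x j + t * d j) \<longlongrightarrow> x j + 0 * d j) (at_right 0)" by (intro tendsto_intros)
    moreover have "0 < x j + 0 * d j" using False assms(2)[OF j] by simp
    ultimately have "\<forall>\<^sub>F t in at_right 0. 0 < x j + t * d j" by (rule order_tendstoD(1))
    then show ?thesis by (rule eventually_mono) simp
  qed
  then have "\<forall>\<^sub>F t in at_right (0::real). \<forall>j\<in>J. 0 \<le> x j + t * d j"
    using assms(1) by (simp add: eventually_ball_finite_distrib)
  then have "\<forall>\<^sub>F t in at_right (0::real). 0 < t \<and> (\<forall>j\<in>J. 0 \<le> x j + t * d j)"
    using eventually_at_right_less[of "0::real"] by (rule eventually_conj[rotated])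
  then show ?thesis
    using eventually_happens'[of "at_right (0::real)"] by (simp add: trivial_limit_at_right_real Bex_def)
qed

section \<open>Complementary slackness for optimal pairs\<close>

lemma scalar_prod_add_transpose:
  assumes "A \<in> carrier_mat m n" "x \<in> carrier_vec n" "y \<in> carrier_vec m" "z \<in> carrier_vec n"
  shows "(transpose_mat A *\<^sub>v y + z) \<bullet> x = (A *\<^sub>v x) \<bullet> y + (x \<bullet> z :: real)"
proof -
  have "(transpose_mat A *\<^sub>v y + z) \<bullet> x = (transpose_mat A *\<^sub>v y) \<bullet> x + z \<bullet> x"
    using assms by (intro add_scalar_prod_distrib[of _ n]) auto
  also have "(transpose_mat A *\<^sub>v y) \<bullet> x = y \<bullet> (A *\<^sub>v x)"
    using assms by (intro transpose_vec_mult_scalar)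
  finally show ?thesis
    using assms by (simp add: comm_scalar_prod[of y m] comm_scalar_prod[of z n])
qed

lemma primal_feasibleD:
  assumes A: "A \<in> carrier_mat m n" and x: "primal_feasible A b x"
  shows "x \<in> carrier_vec n" and "A *\<^sub>v x = b" and "j < n \<Longrightarrow> 0 \<le> x $ j"
proof -
  have *: "x \<in> carrier_vec n" "A *\<^sub>v x = b" "0\<^sub>v n \<le> x"
    using x carrier_matD(2)[OF A] unfolding primal_feasible_def by metis+
  show "x \<in> carrier_vec n" "A *\<^sub>v x = b" by (fact *)+
  show "0 \<le> x $ j" if "j < n"
    using *(1,3) that unfolding less_eq_vec_def by (metis carrier_vecD index_zero_vec(1))
qed

lemma dual_feasibleD:
  assumes A: "A \<in> carrier_mat m n" and yz: "dual_feasible A c y z"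
  shows "y \<in> carrier_vec m" and "z \<in> carrier_vec n" and "transpose_mat A *\<^sub>v y + z = c"
    and "j < n \<Longrightarrow> 0 \<le> z $ j"
proof -
  have *: "y \<in> carrier_vec m" "z \<in> carrier_vec n" "transpose_mat A *\<^sub>v y + z = c" "0\<^sub>v n \<le> z"
    using yz carrier_matD[OF A] unfolding dual_feasible_def by metis+
  show "y \<in> carrier_vec m" "z \<in> carrier_vec n" "transpose_mat A *\<^sub>v y + z = c" by (fact *)+
  show "0 \<le> z $ j" if "j < n"
    using *(2,4) that unfolding less_eq_vec_def by (metis carrier_vecD index_zero_vec(1))
qed

text \<open>The generators for Farkas' lemma are the signed rows of \<open>A\<close> and the unit
  vectors at the zero components of \<open>x\<close>: a vector satisfying their constraints is a
  feasible direction at \<open>x\<close>, along which the optimal cost cannot decrease. Row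
  multipliers form \<open>y\<close>; those of the unit vectors form \<open>z\<close>, which is thus
  supported where \<open>x\<close> vanishes.\<close>

lemma primal_optimal_imp_dual_certificate:
  assumes A: "A \<in> carrier_mat m n" and c: "c \<in> carrier_vec n" and opt: "primal_optimal A b c x"
  shows "\<exists>y z. dual_feasible A c y z \<and> x \<bullet> z = 0"
proof -
  have feas: "primal_feasible A b x" and best: "\<And>x'. primal_feasible A b x' \<Longrightarrow> c \<bullet> x \<le> c \<bullet> x'"
    using opt unfolding primal_optimal_def by blast+
  note x = primal_feasibleD(1)[OF A feas] and Ax = primal_feasibleD(2)[OF A feas]
    and xnn = primal_feasibleD(3)[OF A feas]
  define Z where "Z = {j. j < n \<and> x $ j = 0}"
  have Z: "finite Z" by (simp add: Z_def)
  \<comment> \<open>Each row occurs with both signs because \<open>farkas\<close> yields nonnegative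
    multipliers while \<open>y\<close> is free.\<close>
  define gen :: "nat + nat + nat \<Rightarrow> nat \<Rightarrow> real" where
    "gen s j = (case s of Inl i \<Rightarrow> A $$ (i, j) | Inr (Inl i) \<Rightarrow> - A $$ (i, j)
       | Inr (Inr i) \<Rightarrow> if i = j then 1 else 0)" for s j
  define S where "S = {0..<m} <+> ({0..<m} <+> Z)"
  have "\<exists>l. (\<forall>s\<in>S. 0 \<le> l s) \<and> (\<forall>j\<in>{0..<n}. c $ j = (\<Sum>s\<in>S. l s * gen s j))"
  proof (rule farkas)
    fix d assume d: "\<And>s. s \<in> S \<Longrightarrow> 0 \<le> (\<Sum>j\<in>{0..<n}. gen s j * d j)"
    have rows: "(\<Sum>j\<in>{0..<n}. A $$ (i, j) * d j) = 0" if "i < m" for i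
      using d[of "Inl i"] d[of "Inr (Inl i)"] that by (simp add: S_def gen_def sum_negf InlI InrI)
    have unit: "0 \<le> d j" if "j \<in> Z" for j
    proof -
      have "(\<Sum>i\<in>{0..<n}. gen (Inr (Inr j)) i * d i) = (\<Sum>i\<in>{0..<n}. if j = i then d i else 0)"
        by (rule sum.cong) (auto simp: gen_def)
      then show ?thesis using d[of "Inr (Inr j)"] that by (simp add: S_def Z_def InrI)
    qed
    obtain t where t: "t > 0" "\<forall>j\<in>{0..<n}. 0 \<le> x $ j + t * d j"
      using nonneg_small_step[of "{0..<n}" "\<lambda>j. x $ j" d] xnn unit by (auto simp: Z_def)
    define v where "v = vec n d"
    have v: "v \<in> carrier_vec n" by (simp add: v_def)
    have "A *\<^sub>v v = 0\<^sub>v m"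
      using A rows by (intro eq_vecI) (auto simp: v_def scalar_prod_def)
    then have "A *\<^sub>v (x + t \<cdot>\<^sub>v v) = b"
      using A x v Ax by (simp add: mult_add_distrib_mat_vec mult_mat_vec) (use Ax in auto)
    then have "primal_feasible A b (x + t \<cdot>\<^sub>v v)"
      using A x t(2) by (auto simp: primal_feasible_def less_eq_vec_def v_def)
    then have "c \<bullet> x \<le> c \<bullet> (x + t \<cdot>\<^sub>v v)" by (rule best)
    also have "\<dots> = c \<bullet> x + t * (c \<bullet> v)"
      using c x v by (simp add: scalar_prod_add_distrib[of c n])
    finally have "0 \<le> c \<bullet> v" using t(1) by (simp add: zero_le_mult_iff)
    then show "0 \<le> (\<Sum>j\<in>{0..<n}. c $ j * d j)" by (simp add: scalar_prod_def v_def)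
  qed (simp_all add: S_def Z)
  then obtain l where l: "\<forall>s\<in>S. 0 \<le> l s"
    and cl: "\<forall>j\<in>{0..<n}. c $ j = (\<Sum>s\<in>S. l s * gen s j)" by blast
  define y where "y = vec m (\<lambda>i. l (Inl i) - l (Inr (Inl i)))"
  define z where "z = vec n (\<lambda>j. if x $ j = 0 then l (Inr (Inr j)) else 0)"
  have "c $ j = (transpose_mat A *\<^sub>v y + z) $ j" if j: "j < n" for j
  proof -
    have "(\<Sum>i\<in>Z. l (Inr (Inr i)) * gen (Inr (Inr i)) j) = (\<Sum>i\<in>Z. if i = j then l (Inr (Inr j)) else 0)"
      by (rule sum.cong) (auto simp: gen_def)
    also have "\<dots> = z $ j" using j Z by (simp add: z_def Z_def)
    finally have zj: "(\<Sum>i\<in>Z. l (Inr (Inr i)) * gen (Inr (Inr i)) j) = z $ j" .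
    have yj: "(\<Sum>i\<in>{0..<m}. l (Inl i) * gen (Inl i) j) + (\<Sum>i\<in>{0..<m}. l (Inr (Inl i)) * gen (Inr (Inl i)) j)
        = (transpose_mat A *\<^sub>v y) $ j"
      using A j by (simp add: gen_def y_def scalar_prod_def sum.distrib[symmetric] algebra_simps)
    have "c $ j = (transpose_mat A *\<^sub>v y) $ j + z $ j"
      unfolding cl[rule_format, of j, simplified, OF j] S_def using Z zj yj by (simp add: sum.Plus o_def)
    then show ?thesis using A j by (simp add: z_def)
  qed
  then have "dual_feasible A c y z"
    using A c l unfolding dual_feasible_def
    by (auto intro!: eq_vecI simp: y_def z_def less_eq_vec_def S_def Z_def InrI)
  moreover have "x \<bullet> z = 0" unfolding scalar_prod_def by (auto simp: z_def)
  ultimately show ?thesis by blast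
qed

text \<open>The optimal \<open>y\<close> is at least as good as the dual certificate, whose duality
  gap is 0. Hence its own gap, a sum of nonnegative products, is at most 0.\<close>

lemma complementary_slackness:
  assumes A: "A \<in> carrier_mat m n" and c: "c \<in> carrier_vec n"
    and x: "primal_optimal A b c x" and yz: "dual_optimal A b c y z" and j: "j < n"
  shows "x $ j * z $ j = 0"
proof -
  obtain y' z' where d': "dual_feasible A c y' z'" and z': "x \<bullet> z' = 0"
    using primal_optimal_imp_dual_certificate[OF A c x] by blast
  have p: "primal_feasible A b x" using x unfolding primal_optimal_def by blast
  note xc = primal_feasibleD(1)[OF A p] and Ax = primal_feasibleD(2)[OF A p]
    and x0 = primal_feasibleD(3)[OF A p]
  have d: "dual_feasible A c y z" and le: "b \<bullet> y' \<le> b \<bullet> y"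
    using yz d' unfolding dual_optimal_def by blast+
  note z0 = dual_feasibleD(4,2)[OF A d]
  have gap: "c \<bullet> x = b \<bullet> y'' + x \<bullet> z''" if "dual_feasible A c y'' z''" for y'' z''
    using scalar_prod_add_transpose[OF A xc dual_feasibleD(1,2)[OF A that]]
    unfolding dual_feasibleD(3)[OF A that] Ax .
  have "x \<bullet> z \<le> 0" using gap[OF d] gap[OF d'] z' le by linarith
  then have "(\<Sum>j\<in>{0..<n}. x $ j * z $ j) \<le> 0" using z0 by (simp add: scalar_prod_def)
  then have "(\<Sum>j\<in>{0..<n}. x $ j * z $ j) = 0"
    using x0 z0 by (intro antisym sum_nonneg) auto
  then show ?thesis
    using j x0 z0 sum_nonneg_eq_0_iff[of "{0..<n}" "\<lambda>j. x $ j * z $ j"] by auto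
qed


subsection \<open>Solvability of the Newton system\<close>

text \<open>A maximal independent set of columns has \<open>m\<close> elements, so it is a
  basis.\<close>

lemma surj_if_full_row_rank:
  fixes A :: "'a :: field mat"
  assumes A: "A \<in> carrier_mat m n" and rank: "vec_space.rank m A = m" and b: "b \<in> carrier_vec m"
  shows "\<exists>x\<in>carrier_vec n. A *\<^sub>v x = b"
proof -
  interpret vec_space "TYPE('a)" m .
  have cols: "set (cols A) \<subseteq> carrier_vec m" using A cols_dim by blast
  have "\<exists>S. maximal S (\<lambda>T. T \<subseteq> set (cols A) \<and> lin_indpt T)"
    using maximal_exists_superset[of "set (cols A)" "\<lambda>T. T \<subseteq> set (cols A) \<and> lin_indpt T" "{}"]
    by (auto simp: finite_lin_indpt2)
  then obtain S where S: "maximal S (\<lambda>T. T \<subseteq> set (cols A) \<and> lin_indpt T)" by blast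
  then have sub: "S \<subseteq> set (cols A)" and ind: "lin_indpt S" by (auto simp: maximal_def)
  have "card S = m" using rank_card_indpt[OF A S] rank by simp
  then have "basis S"
    using dim_li_is_basis[OF fin_dim] sub cols ind finite_subset[OF sub] dim_is_n by auto
  then have "span S = carrier_vec m" by (simp add: basis_def)
  then have "b \<in> span (set (cols A))"
    using b span_is_monotone[OF sub] by auto
  then show ?thesis
    using col_space_eq[OF A] A unfolding col_space_def by auto
qed

lemma scalar_prod_self_eq_0:
  fixes v :: "real vec"
  assumes v: "v \<in> carrier_vec n" and "v \<bullet> v = 0"
  shows "v = 0\<^sub>v n"
proof (rule eq_vecI)
  have "(\<Sum>i\<in>{0..<n}. v $ i * v $ i) = 0" using assms by (simp add: scalar_prod_def)
  then have "\<forall>i\<in>{0..<n}. v $ i * v $ i = 0"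
    by (subst (asm) sum_nonneg_eq_0_iff) auto
  then show "v $ i = 0\<^sub>v n $ i" if "i < dim_vec (0\<^sub>v n)" for i using that by simp
qed (use v in simp)

text \<open>If the Gram matrix kills \<open>y\<close>, then so does the transpose of
  \<open>M\<close>; writing \<open>y = M *\<^sub>v x\<close> gives \<open>y \<bullet> y = 0\<close>.
  So the Gram matrix is nonsingular.\<close>

lemma gram_matrix_surj:
  fixes M :: "real mat"
  assumes M: "M \<in> carrier_mat m n"
    and surj: "\<And>y. y \<in> carrier_vec m \<Longrightarrow> \<exists>x\<in>carrier_vec n. M *\<^sub>v x = y"
    and b: "b \<in> carrier_vec m"
  shows "\<exists>y\<in>carrier_vec m. (M * transpose_mat M) *\<^sub>v y = b"
proof -
  let ?N = "M * transpose_mat M"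
  have N: "?N \<in> carrier_mat m m" using M by simp
  have "det ?N \<noteq> 0"
  proof
    assume "det ?N = 0"
    then obtain y where y: "y \<in> carrier_vec m" "y \<noteq> 0\<^sub>v m" "?N *\<^sub>v y = 0\<^sub>v m"
      using det_0_iff_vec_prod_zero_field[OF N] by auto
    let ?t = "transpose_mat M *\<^sub>v y"
    have t: "?t \<in> carrier_vec n" using M y by simp
    have "?t \<bullet> ?t = y \<bullet> (M *\<^sub>v ?t)"
      by (rule transpose_vec_mult_scalar[OF M t y(1)])
    also have "M *\<^sub>v ?t = 0\<^sub>v m"
      using y(3) assoc_mult_mat_vec[OF M _ y(1), of "transpose_mat M"] M by simp
    also have "y \<bullet> 0\<^sub>v m = 0" using y(1) by simp
    finally have "?t = 0\<^sub>v n" using t by (rule scalar_prod_self_eq_0[rotated])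
    moreover obtain x where x: "x \<in> carrier_vec n" "M *\<^sub>v x = y" using surj[OF y(1)] by blast
    ultimately have "y \<bullet> y = 0"
      using transpose_vec_mult_scalar[OF M x(1) y(1)] x by simp
    then show False using scalar_prod_self_eq_0[OF y(1)] y(2) by blast
  qed
  then have "vec_space.rank m ?N = m" using vec_space.det_rank_iff[OF N] by blast
  then show ?thesis using surj_if_full_row_rank[OF N _ b] by blast
qed

lemma mat_diag_mult_vec:
  assumes "v \<in> carrier_vec n"
  shows "mat_diag n f *\<^sub>v v = vec n (\<lambda>i. f i * v $ i :: real)"
proof (rule eq_vecI)
  fix i assume i: "i < dim_vec (vec n (\<lambda>i. f i * v $ i))"
  have "(mat_diag n f *\<^sub>v v) $ i = (\<Sum>j\<in>{0..<n}. (if i = j then f j else 0) * v $ j)"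
    using assms i by (auto simp: mat_diag_def scalar_prod_def)
  also have "\<dots> = (\<Sum>j\<in>{0..<n}. if i = j then f j * v $ j else 0)"
    by (rule sum.cong) auto
  also have "\<dots> = f i * v $ i" using i by simp
  finally show "(mat_diag n f *\<^sub>v v) $ i = vec n (\<lambda>i. f i * v $ i) $ i" using i by simp
qed (simp add: mat_diag_def)

text \<open>Block elimination: with \<open>M = A * D\<close>, the last two equations express
  \<open>du\<close> and \<open>dv\<close> by \<open>dy\<close>, and the first becomes a system with
  the Gram matrix of \<open>M\<close>.\<close>

lemma newton_solution_exists:
  assumes A: "A \<in> carrier_mat m n" and rank: "vec_space.rank m A = m"
    and b: "b \<in> carrier_vec m" and c: "c \<in> carrier_vec n"
    and x: "x \<in> carrier_vec n" "positive_vec x" and y: "y \<in> carrier_vec m"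
    and z: "z \<in> carrier_vec n" "positive_vec z"
  shows "\<exists>du dy dv. newton_solution A b c \<mu> x y z (0\<^sub>v n) du dy dv"
proof -
  define D where "D = scal_D x z"
  have D_diag: "D = mat_diag n (\<lambda>i. sqrt (x $ i) / sqrt (z $ i))" using x by (simp add: D_def scal_D_def)
  have D: "D \<in> carrier_mat n n" by (simp add: D_diag)
  define M where "M = A * D"
  have M: "M \<in> carrier_mat m n" using A D by (simp add: M_def)
  have "transpose_mat D = D" unfolding D_diag by (rule eq_matI) (auto simp: mat_diag_def)
  then have MT: "transpose_mat M = D * transpose_mat A"
    unfolding M_def using transpose_mult[OF A D] by simp
  have surj: "\<exists>v\<in>carrier_vec n. M *\<^sub>v v = y'" if y': "y' \<in> carrier_vec m" for y'
  proof -
    obtain v where v: "v \<in> carrier_vec n" "A *\<^sub>v v = y'"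
      using surj_if_full_row_rank[OF A rank y'] by blast
    define v' where "v' = vec n (\<lambda>i. v $ i / (sqrt (x $ i) / sqrt (z $ i)))"
    have v': "v' \<in> carrier_vec n" by (simp add: v'_def)
    have "x $ i \<noteq> 0 \<and> z $ i \<noteq> 0" if "i < n" for i
      using that x z unfolding positive_vec_def by (metis carrier_vecD less_irrefl)
    then have "D *\<^sub>v v' = v"
      unfolding D_diag mat_diag_mult_vec[OF v'] using v(1) by (intro eq_vecI) (auto simp: v'_def)
    then have "M *\<^sub>v v' = y'"
      unfolding M_def using assoc_mult_mat_vec[OF A D v'] v(2) by simp
    then show ?thesis using v' by blast
  qed
  define q where "q = vec_q A c x y z"
  define r where "r = vec_r \<mu> x z"
  have q: "q \<in> carrier_vec n"
    using A c x y z D unfolding q_def vec_q_def D_def[symmetric] by auto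
  have r: "r \<in> carrier_vec n"
    using x by (auto simp: r_def vec_r_def vec_w_def scal_W_def scal_W_inv_def ones_def
        mat_diag_mult_vec)
  have p: "vec_p A b x \<in> carrier_vec m" using A b x by (simp add: vec_p_def)
  obtain dy where dy: "dy \<in> carrier_vec m"
    and dy_eq: "(M * transpose_mat M) *\<^sub>v dy = vec_p A b x - M *\<^sub>v (r - q)"
    using gram_matrix_surj[OF M surj, of "vec_p A b x - M *\<^sub>v (r - q)"] p M q r by auto
  define t where "t = transpose_mat M *\<^sub>v dy"
  have t: "t \<in> carrier_vec n" using M dy by (simp add: t_def)
  have Mt: "M *\<^sub>v t = vec_p A b x - M *\<^sub>v (r - q)"
    using dy_eq assoc_mult_mat_vec[OF M _ dy, of "transpose_mat M"] M by (simp add: t_def)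
  have "M *\<^sub>v (r - q + t) = vec_p A b x"
  proof -
    have "M *\<^sub>v (r - q + t) = M *\<^sub>v (r - q) + M *\<^sub>v t"
      using M q r t by (intro mult_add_distrib_mat_vec) auto
    also have "\<dots> = vec_p A b x"
      unfolding Mt using p M q r by (intro eq_vecI) auto
    finally show ?thesis .
  qed
  moreover have "t + (q - t) = q" using q t by (intro eq_vecI) auto
  moreover have "(r - q + t) + (q - t) = r + 0\<^sub>v n" using q r t by (intro eq_vecI) auto
  ultimately have "newton_solution A b c \<mu> x y z (0\<^sub>v n) (r - q + t) dy (q - t)"
    using A q r t dy unfolding newton_solution_def D_def[symmetric] M_def[symmetric] MT[symmetric]
      t_def[symmetric] q_def[symmetric] r_def[symmetric] by auto
  then show ?thesis by blast
qed


subsection \<open>Bounds on the Newton direction\<close>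

text \<open>Componentwise form of the orthogonality between the kernel of a matrix and the range of
  its transpose. It is applied both to the Newton direction and to the comparison of the iterate
  with the solution.\<close>

lemma sum_mult_eq_0_if_kernel_range:
  fixes a :: "'i \<Rightarrow> 'j \<Rightarrow> real"
  assumes "\<And>i. i \<in> I \<Longrightarrow> (\<Sum>j\<in>J. a i j * h j) = 0"
    and "\<And>j. j \<in> J \<Longrightarrow> (\<Sum>i\<in>I. a i j * y i) + k j = 0"
  shows "(\<Sum>j\<in>J. h j * k j) = 0"
proof -
  have "(\<Sum>j\<in>J. h j * k j) = (\<Sum>j\<in>J. h j * (- (\<Sum>i\<in>I. a i j * y i)))"
    using assms(2) by (intro sum.cong refl arg_cong2[of _ _ _ _ "(*)"]) (auto simp: eq_neg_iff_add_eq_0 add.commute)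
  also have "\<dots> = - (\<Sum>j\<in>J. \<Sum>i\<in>I. y i * (a i j * h j))"
    by (simp add: sum_negf sum_distrib_left mult_ac)
  also have "(\<Sum>j\<in>J. \<Sum>i\<in>I. y i * (a i j * h j)) = (\<Sum>i\<in>I. y i * (\<Sum>j\<in>J. a i j * h j))"
    by (subst sum.swap) (simp add: sum_distrib_left)
  finally show ?thesis using assms(1) by simp
qed

text \<open>
  An infeasible point whose residuals are \<open>\<theta>\<close> times those of \<open>(\<rho> e, 0, \<rho> e)\<close>, and a
  complementary solution bounded by \<open>\<rho>\<close>.
\<close>
locale infeasible_point =
  fixes I :: "'i set" and J :: "'j set" and a :: "'i \<Rightarrow> 'j \<Rightarrow> real" and b :: "'i \<Rightarrow> real"
    and c :: "'j \<Rightarrow> real" and x :: "'j \<Rightarrow> real" and y :: "'i \<Rightarrow> real" and z :: "'j \<Rightarrow> real"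
    and xs :: "'j \<Rightarrow> real" and ys :: "'i \<Rightarrow> real" and zs :: "'j \<Rightarrow> real" and \<theta> \<rho> :: real
  assumes primal_residual:
      "\<And>i. i \<in> I \<Longrightarrow> (\<Sum>j\<in>J. a i j * x j) - b i = \<theta> * ((\<Sum>j\<in>J. a i j * \<rho>) - b i)"
    and dual_residual:
      "\<And>j. j \<in> J \<Longrightarrow> (\<Sum>i\<in>I. a i j * y i) + z j - c j = \<theta> * (\<rho> - c j)"
    and primal_solution: "\<And>i. i \<in> I \<Longrightarrow> (\<Sum>j\<in>J. a i j * xs j) = b i"
    and dual_solution: "\<And>j. j \<in> J \<Longrightarrow> (\<Sum>i\<in>I. a i j * ys i) + zs j = c j"
    and xs_bounds: "\<And>j. j \<in> J \<Longrightarrow> 0 \<le> xs j \<and> xs j \<le> \<rho>"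
    and zs_bounds: "\<And>j. j \<in> J \<Longrightarrow> 0 \<le> zs j \<and> zs j \<le> \<rho>"
    and complementary: "\<And>j. j \<in> J \<Longrightarrow> xs j * zs j = 0"
    and x_pos: "\<And>j. j \<in> J \<Longrightarrow> 0 < x j" and z_pos: "\<And>j. j \<in> J \<Longrightarrow> 0 < z j"
    and theta: "0 \<le> \<theta>" "\<theta> \<le> 1"
    and theta_gap: "\<theta> * (real (card J) * \<rho>\<^sup>2) \<le> (\<Sum>j\<in>J. x j * z j)"
begin

text \<open>\<open>dx\<close> removes the residual that \<open>\<theta> * (\<rho> - xs)\<close>
  creates, so their sum lies in the kernel of \<open>a\<close>; the dual counterpart lies in the
  range of the transpose, with multiplier \<open>dy - \<theta> * ys\<close> up to sign.\<close>

lemma newton_direction_orthogonal: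
  assumes "\<And>i. i \<in> I \<Longrightarrow> (\<Sum>j\<in>J. a i j * dx j) = b i - (\<Sum>j\<in>J. a i j * x j)"
    and "\<And>j. j \<in> J \<Longrightarrow> (\<Sum>i\<in>I. a i j * dy i) + dz j = c j - (\<Sum>i\<in>I. a i j * y i) - z j"
  shows "(\<Sum>j\<in>J. (dx j + \<theta> * (\<rho> - xs j)) * (dz j + \<theta> * (\<rho> - zs j))) = 0"
proof (rule sum_mult_eq_0_if_kernel_range)
  fix i assume i: "i \<in> I"
  have "(\<Sum>j\<in>J. a i j * (dx j + \<theta> * (\<rho> - xs j)))
      = (\<Sum>j\<in>J. a i j * dx j) + \<theta> * ((\<Sum>j\<in>J. a i j * \<rho>) - (\<Sum>j\<in>J. a i j * xs j))"
    by (simp add: algebra_simps sum.distrib sum_subtractf sum_distrib_left)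
  then show "(\<Sum>j\<in>J. a i j * (dx j + \<theta> * (\<rho> - xs j))) = 0"
    using assms(1)[OF i] primal_residual[OF i] primal_solution[OF i] by simp
next
  fix j assume j: "j \<in> J"
  have "(\<Sum>i\<in>I. a i j * (dy i - \<theta> * ys i)) = (\<Sum>i\<in>I. a i j * dy i) - \<theta> * (\<Sum>i\<in>I. a i j * ys i)"
    by (simp add: algebra_simps sum_subtractf sum_distrib_left)
  also have "(\<Sum>i\<in>I. a i j * ys i) = c j - zs j" using dual_solution[OF j] by simp
  finally have eq: "(\<Sum>i\<in>I. a i j * (dy i - \<theta> * ys i)) = (\<Sum>i\<in>I. a i j * dy i) - \<theta> * (c j - zs j)" .
  show "(\<Sum>i\<in>I. a i j * (dy i - \<theta> * ys i)) + (dz j + \<theta> * (\<rho> - zs j)) = 0"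
    using assms(2)[OF j] dual_residual[OF j] unfolding eq unfolding right_diff_distrib by linarith
qed

text \<open>
  The two components of the difference of \<open>(x, z)\<close> and
  \<open>\<theta> (\<rho> e, \<rho> e) + (1 - \<theta>) (xs, zs)\<close> are orthogonal to each other; complementarity bounds
  the gap of that combination by \<open>\<theta> n \<rho>\<^sup>2\<close>.
\<close>
lemma scaled_distance_bound:
  "(\<Sum>j\<in>J. \<theta> * (\<rho> - xs j) * z j + \<theta> * (\<rho> - zs j) * x j) \<le> 2 * (\<Sum>j\<in>J. x j * z j)"
proof -
  define p q where "p j = xs j + \<theta> * (\<rho> - xs j)" and "q j = zs j + \<theta> * (\<rho> - zs j)" for j
  have orth: "(\<Sum>j\<in>J. (x j - p j) * (z j - q j)) = 0"
  proof (rule sum_mult_eq_0_if_kernel_range)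
    fix i assume i: "i \<in> I"
    have "(\<Sum>j\<in>J. a i j * (x j - p j)) = (\<Sum>j\<in>J. a i j * x j) - (\<Sum>j\<in>J. a i j * xs j)
        - \<theta> * ((\<Sum>j\<in>J. a i j * \<rho>) - (\<Sum>j\<in>J. a i j * xs j))"
      by (simp add: p_def algebra_simps sum.distrib sum_subtractf sum_distrib_left)
    then show "(\<Sum>j\<in>J. a i j * (x j - p j)) = 0"
      using primal_residual[OF i] primal_solution[OF i] by simp
  next
    fix j assume j: "j \<in> J"
    have "(\<Sum>i\<in>I. a i j * (y i - (1 - \<theta>) * ys i))
        = (\<Sum>i\<in>I. a i j * y i) - (1 - \<theta>) * (\<Sum>i\<in>I. a i j * ys i)"
      by (simp add: algebra_simps sum.distrib sum_subtractf sum_distrib_left)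
    also have "(\<Sum>i\<in>I. a i j * ys i) = c j - zs j" using dual_solution[OF j] by simp
    finally have eq: "(\<Sum>i\<in>I. a i j * (y i - (1 - \<theta>) * ys i))
        = (\<Sum>i\<in>I. a i j * y i) - (1 - \<theta>) * (c j - zs j)" .
    show "(\<Sum>i\<in>I. a i j * (y i - (1 - \<theta>) * ys i)) + (z j - q j) = 0"
      using dual_residual[OF j] unfolding eq q_def by (simp add: algebra_simps)
  qed
  have "\<theta> * (\<rho> - xs j) * z j + \<theta> * (\<rho> - zs j) * x j \<le> x j * z j + \<theta> * \<rho>\<^sup>2 - (x j - p j) * (z j - q j)"
    if j: "j \<in> J" for j
  proof -
    \<comment> \<open>By complementarity one factor is exactly \<open>\<theta> * \<rho>\<close>; the
      other, a convex combination of numbers up to \<open>\<rho>\<close>, is at most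
      \<open>\<rho>\<close>.\<close>
    have "p j * q j \<le> \<theta> * \<rho>\<^sup>2"
    proof (cases "xs j = 0")
      case True
      have "q j \<le> \<rho>"
        using zs_bounds[OF j] theta mult_left_le_one_le[of "\<rho> - zs j" \<theta>] by (simp add: q_def)
      then have "\<theta> * \<rho> * q j \<le> \<theta> * \<rho> * \<rho>"
        using theta zs_bounds[OF j] by (intro mult_left_mono) auto
      then show ?thesis using True by (simp add: p_def power2_eq_square mult_ac)
    next
      case False
      then have zs: "zs j = 0" using complementary[OF j] by simp
      have "p j \<le> \<rho>"
        using xs_bounds[OF j] theta mult_left_le_one_le[of "\<rho> - xs j" \<theta>] by (simp add: p_def)
      then have "\<theta> * \<rho> * p j \<le> \<theta> * \<rho> * \<rho>"
        using theta xs_bounds[OF j] by (intro mult_left_mono) auto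
      then show ?thesis using zs by (simp add: q_def power2_eq_square mult_ac)
    qed
    \<comment> \<open>These products are dropped from the expansion of
      \<open>(x j - p j) * (z j - q j)\<close>.\<close>
    moreover have "0 \<le> x j * zs j" "0 \<le> z j * xs j"
      using x_pos[OF j] z_pos[OF j] xs_bounds[OF j] zs_bounds[OF j] by simp_all
    moreover have "x j * q j = x j * zs j + \<theta> * (\<rho> - zs j) * x j"
      and "z j * p j = z j * xs j + \<theta> * (\<rho> - xs j) * z j"
      by (simp_all add: p_def q_def algebra_simps)
    moreover have "(x j - p j) * (z j - q j) = x j * z j - x j * q j - z j * p j + p j * q j"
      by (simp add: algebra_simps)
    ultimately show ?thesis by linarith
  qed
  then have "(\<Sum>j\<in>J. \<theta> * (\<rho> - xs j) * z j + \<theta> * (\<rho> - zs j) * x j)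
      \<le> (\<Sum>j\<in>J. x j * z j + \<theta> * \<rho>\<^sup>2 - (x j - p j) * (z j - q j))" by (rule sum_mono)
  also have "\<dots> = (\<Sum>j\<in>J. x j * z j) + \<theta> * (real (card J) * \<rho>\<^sup>2)"
    using orth by (simp add: sum.distrib sum_subtractf mult_ac)
  finally show ?thesis using theta_gap by linarith
qed

end

section \<open>Length of the scaled Newton direction\<close>

context scaled_point
begin

text \<open>Condition (b) lets \<open>\<kappa>\<close> times the length of \<open>u\<close> be moved
  to the left, which is the origin of the denominator \<open>1 - \<kappa>\<close>. The hypotheses
  are symmetric enough to be reused with \<open>u\<close>, \<open>f\<close> and \<open>v\<close>,
  \<open>g\<close> exchanged.\<close>

lemma newton_direction_bound:
  assumes orth: "(\<Sum>i\<in>I. (u i + f i) * (v i + g i)) = 0"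
    and fg: "\<And>i. i \<in> I \<Longrightarrow> 0 \<le> f i \<and> 0 \<le> g i"
    and dist: "(\<Sum>i\<in>I. f i * w i + g i * w i) \<le> 2 * gap"
    and uv: "\<And>i. i \<in> I \<Longrightarrow> u i + v i = r i + \<xi> i"
    and xi: "L2_set \<xi> I \<le> \<kappa> * L2_set u I" and kappa: "\<kappa> < 1"
  shows "L2_set u I \<le> 3 * (n + \<nu>) / (1 - \<kappa>) * R"
proof -
  have "L2_set (\<lambda>i. u i + v i) I = L2_set (\<lambda>i. r i + \<xi> i) I"
    using uv by (intro L2_set_cong) auto
  also have "\<dots> \<le> R + L2_set \<xi> I" unfolding R_def by (rule L2_set_triangle_ineq)
  finally have uv_le: "L2_set (\<lambda>i. u i + v i) I \<le> R + \<kappa> * L2_set u I" using xi by linarith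
  have "(L2_set f I + L2_set g I) * wmin \<le> (\<Sum>i\<in>I. f i + g i) * wmin"
    using fg L2_set_le_sum[of I f] L2_set_le_sum[of I g] wmin_pos
    by (intro mult_right_mono) (auto simp: sum.distrib)
  also have "\<dots> \<le> (\<Sum>i\<in>I. f i * w i + g i * w i)"
    unfolding sum_distrib_right
  proof (rule sum_mono)
    fix i assume i: "i \<in> I"
    show "(f i + g i) * wmin \<le> f i * w i + g i * w i"
      using fg[OF i] wmin_le[OF i] by (simp add: distrib_right add_mono mult_left_mono)
  qed
  also have "\<dots> \<le> 2 * (n + \<nu>) * \<mu>" using dist unfolding gap_eq by (simp only: mult_ac)
  also have "\<dots> \<le> 2 * (n + \<nu>) * (100 / 86 * (R * wmin))"
    using R_wmin_lower n_ge_1 nu_ge_1 by (intro mult_left_mono) auto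
  also have "\<dots> = 200 / 86 * ((n + \<nu>) * R) * wmin" by simp
  finally have fg_le: "L2_set f I + L2_set g I \<le> 200 / 86 * ((n + \<nu>) * R)"
    using wmin_pos by (rule mult_right_le_imp_le)
  \<comment> \<open>In units of \<open>(n + \<nu>) * R\<close>, the residual contributes 1/2 and the
    distance 200/86, together less than 3.\<close>
  have "2 * R \<le> (n + \<nu>) * R" using n_ge_1 nu_ge_1 R_pos by (intro mult_right_mono) auto
  then have "L2_set u I - \<kappa> * L2_set u I \<le> 3 * ((n + \<nu>) * R)"
    using R_pos L2_set_le_if_orthogonal[OF orth] uv_le fg_le by linarith
  moreover have "L2_set u I - \<kappa> * L2_set u I = L2_set u I * (1 - \<kappa>)"
    by (simp add: algebra_simps)
  ultimately have "L2_set u I * (1 - \<kappa>) \<le> 3 * (n + \<nu>) * R"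
    by (simp only: mult.assoc)
  then show ?thesis using kappa by (simp only: times_divide_eq_left pos_le_divide_eq diff_gt_0_iff_gt)
qed

end


subsection \<open>Vectors and components\<close>

lemma eucl_norm_eq_L2_set:
  assumes "v \<in> carrier_vec n"
  shows "eucl_norm v = L2_set (\<lambda>i. v $ i) {0..<n}"
  using assms by (simp add: eucl_norm_def L2_set_def scalar_prod_def power2_eq_square)

lemma eucl_norm_smult: "0 \<le> t \<Longrightarrow> eucl_norm (t \<cdot>\<^sub>v v) = t * eucl_norm v"
  unfolding eucl_norm_eq_L2_set[OF carrier_vec_dim_vec]
  by (simp add: L2_set_right_distrib cong: L2_set_cong_simp)

lemma mult_mat_vec_index:
  assumes "A \<in> carrier_mat m n" "x \<in> carrier_vec n" "i < m"
  shows "(A *\<^sub>v x) $ i = (\<Sum>j\<in>{0..<n}. A $$ (i, j) * x $ j)"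
  using assms by (simp add: scalar_prod_def)

lemma transpose_mult_mat_vec_index:
  assumes "A \<in> carrier_mat m n" "y \<in> carrier_vec m" "j < n"
  shows "(transpose_mat A *\<^sub>v y) $ j = (\<Sum>i\<in>{0..<m}. A $$ (i, j) * y $ i)"
  using assms by (simp add: scalar_prod_def)

lemma mult_mat_vec_step:
  assumes "A \<in> carrier_mat m n" "x \<in> carrier_vec n" "dx \<in> carrier_vec n"
  shows "A *\<^sub>v (x + \<alpha> \<cdot>\<^sub>v dx) = A *\<^sub>v x + \<alpha> \<cdot>\<^sub>v (A *\<^sub>v dx :: real vec)"
  using assms by (simp add: mult_add_distrib_mat_vec mult_mat_vec)

lemma abs_index_le_max_norm: "i < dim_vec v \<Longrightarrow> \<bar>v $ i\<bar> \<le> max_norm v"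
proof -
  have "{\<bar>v $ i\<bar> |i. i < dim_vec v} = (\<lambda>i. \<bar>v $ i\<bar>) ` {..<dim_vec v}" by auto
  then show "i < dim_vec v \<Longrightarrow> \<bar>v $ i\<bar> \<le> max_norm v"
    unfolding max_norm_def by (intro Max_ge) auto
qed

text \<open>Undoes the scaling. The diagonal entry of \<open>D\<close> equals \<open>x $ i\<close>
  divided by the root of \<open>x $ i * z $ i\<close>, so \<open>dx\<close> and \<open>dz\<close>
  become relative changes of \<open>x\<close> and \<open>z\<close>, and the two linear equations
  lose their scaling matrices.\<close>

lemma search_directionE:
  fixes x z dx dy dz :: rvec
  assumes A: "A \<in> carrier_mat m n" and b: "b \<in> carrier_vec m" and c: "c \<in> carrier_vec n"
    and x: "x \<in> carrier_vec n" "positive_vec x" and y: "y \<in> carrier_vec m"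
    and z: "z \<in> carrier_vec n" "positive_vec z"
    and dir: "search_direction A b c \<nu> \<kappa> x y z dx dy dz"
  obtains u v \<xi> :: rvec
  where "dx \<in> carrier_vec n" "dy \<in> carrier_vec m" "dz \<in> carrier_vec n"
    and "A *\<^sub>v dx = b - A *\<^sub>v x"
    and "transpose_mat A *\<^sub>v dy + dz = c - transpose_mat A *\<^sub>v y - z"
    and "\<And>i. i < n \<Longrightarrow> dx $ i = x $ i * (u $ i / sqrt (x $ i * z $ i))"
    and "\<And>i. i < n \<Longrightarrow> dz $ i = z $ i * (v $ i / sqrt (x $ i * z $ i))"
    and "\<And>i. i < n \<Longrightarrow> u $ i + v $ i
       = (- sqrt (x $ i * z $ i) + (x \<bullet> z) / (n + \<nu>) / sqrt (x $ i * z $ i)) + \<xi> $ i"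
    and "- (\<Sum>i\<in>{0..<n}. (- sqrt (x $ i * z $ i) + (x \<bullet> z) / (n + \<nu>) / sqrt (x $ i * z $ i)) * \<xi> $ i)
       \<le> \<kappa> * (L2_set (\<lambda>i. - sqrt (x $ i * z $ i) + (x \<bullet> z) / (n + \<nu>) / sqrt (x $ i * z $ i)) {0..<n})\<^sup>2"
    and "L2_set (\<lambda>i. \<xi> $ i) {0..<n} \<le> \<kappa> * min (L2_set (\<lambda>i. u $ i) {0..<n}) (L2_set (\<lambda>i. v $ i) {0..<n})"
    and "- (\<Sum>i\<in>{0..<n}. sqrt (x $ i * z $ i) * \<xi> $ i) \<le> \<kappa> * (n / (n + \<nu>)) * (x \<bullet> z)"
proof -
  define \<mu> where "\<mu> = (x \<bullet> z) / (n + \<nu>)"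
  define w where "w = vec n (\<lambda>i. sqrt (x $ i * z $ i))"
  define r where "r = vec n (\<lambda>i. - sqrt (x $ i * z $ i) + \<mu> / sqrt (x $ i * z $ i))"
  have pos: "0 < x $ i" "0 < z $ i" if "i < n" for i
    using that x z unfolding positive_vec_def by auto
  have w_eq: "vec_w x z = w"
    using x unfolding vec_w_def scal_W_def w_def
    by (intro eq_vecI) (simp_all add: mat_diag_mult_vec[of _ n] ones_def)
  have "scal_W_inv x z *\<^sub>v ones (dim_vec x) = vec n (\<lambda>i. 1 / sqrt (x $ i * z $ i))"
    using x unfolding scal_W_inv_def
    by (intro eq_vecI) (simp_all add: mat_diag_mult_vec[of _ n] ones_def)
  then have r_eq: "vec_r \<mu> x z = r"
    unfolding vec_r_def w_eq by (intro eq_vecI) (simp_all add: r_def w_def)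
  have ww: "(eucl_norm w)\<^sup>2 = x \<bullet> z"
  proof -
    have "(eucl_norm w)\<^sup>2 = (\<Sum>i\<in>{0..<n}. (w $ i)\<^sup>2)"
      unfolding eucl_norm_eq_L2_set[of w n, unfolded w_def, OF vec_carrier, folded w_def] by (rule L2_set_power2)
    also have "\<dots> = (\<Sum>i\<in>{0..<n}. x $ i * z $ i)"
      using pos by (intro sum.cong) (auto simp: w_def less_imp_le)
    finally show ?thesis using z by (simp add: scalar_prod_def)
  qed
  obtain \<xi> du dv where xi: "\<xi> \<in> carrier_vec n"
    and newton: "newton_solution A b c \<mu> x y z \<xi> du dy dv"
    and r_xi: "- (r \<bullet> \<xi>) \<le> \<kappa> * (eucl_norm r)\<^sup>2"
    and norm_xi: "eucl_norm \<xi> \<le> \<kappa> * min (eucl_norm du) (eucl_norm dv)"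
    and w_xi: "- (w \<bullet> \<xi>) \<le> \<kappa> * (n / (n + \<nu>)) * (eucl_norm w)\<^sup>2"
    and dx: "dx = scal_D x z *\<^sub>v du" and dz: "dz = scal_D_inv x z *\<^sub>v dv"
    using dir unfolding search_direction_def Let_def carrier_matD(2)[OF A] \<mu>_def[symmetric] w_eq r_eq
    by blast
  have du: "du \<in> carrier_vec n" and dy: "dy \<in> carrier_vec m" and dv: "dv \<in> carrier_vec n"
    and p: "(A * scal_D x z) *\<^sub>v du = vec_p A b x"
    and q: "(scal_D x z * transpose_mat A) *\<^sub>v dy + dv = vec_q A c x y z"
    and s: "du + dv = r + \<xi>"
    using newton unfolding newton_solution_def carrier_matD[OF A] r_eq by blast+
  have D: "scal_D x z = mat_diag n (\<lambda>i. sqrt (x $ i) / sqrt (z $ i))" "scal_D x z \<in> carrier_mat n n"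
    using x by (simp_all add: scal_D_def)
  have AT: "transpose_mat A \<in> carrier_mat n m" using A by simp
  have dx_vec: "dx = vec n (\<lambda>i. sqrt (x $ i) / sqrt (z $ i) * du $ i)"
    unfolding dx D(1) by (rule mat_diag_mult_vec[OF du])
  have dz_vec: "dz = vec n (\<lambda>i. sqrt (z $ i) / sqrt (x $ i) * dv $ i)"
    using x mat_diag_mult_vec[OF dv] unfolding dz scal_D_inv_def by simp
  show thesis
  proof (rule that[of du dv \<xi>])
    show dxc: "dx \<in> carrier_vec n" and dzc: "dz \<in> carrier_vec n" by (simp_all add: dx_vec dz_vec)
    show "dy \<in> carrier_vec m" by fact
    show "A *\<^sub>v dx = b - A *\<^sub>v x"
      using p assoc_mult_mat_vec[OF A D(2) du] unfolding dx vec_p_def by simp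
    show "transpose_mat A *\<^sub>v dy + dz = c - transpose_mat A *\<^sub>v y - z"
    proof (rule eq_vecI)
      fix j assume "j < dim_vec (c - transpose_mat A *\<^sub>v y - z)"
      then have j: "j < n" using z by simp
      let ?t = "transpose_mat A *\<^sub>v dy" and ?q = "c - transpose_mat A *\<^sub>v y - z"
      have t: "?t \<in> carrier_vec n" and qc: "?q \<in> carrier_vec n"
        using AT dy y c z by auto
      have "(scal_D x z * transpose_mat A) *\<^sub>v dy = scal_D x z *\<^sub>v ?t"
        by (rule assoc_mult_mat_vec[OF D(2) AT dy])
      then have "scal_D x z *\<^sub>v ?t + dv = scal_D x z *\<^sub>v ?q" using q unfolding vec_q_def by simp
      then have "(scal_D x z *\<^sub>v ?t + dv) $ j = (scal_D x z *\<^sub>v ?q) $ j" by simp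
      then have e: "sqrt (x $ j) / sqrt (z $ j) * ?t $ j + dv $ j = sqrt (x $ j) / sqrt (z $ j) * ?q $ j"
        unfolding D(1) mat_diag_mult_vec[OF t] mat_diag_mult_vec[OF qc] using j dv by simp
      \<comment> \<open>Row \<open>j\<close> of the scaled dual equation is divided by the diagonal
        entry of \<open>D\<close>.\<close>
      have "dz $ j = sqrt (z $ j) / sqrt (x $ j) * dv $ j" using j by (simp add: dz_vec)
      also have "dv $ j = sqrt (x $ j) / sqrt (z $ j) * (?q $ j - ?t $ j)"
        using e by (simp only: right_diff_distrib)
      also have "sqrt (z $ j) / sqrt (x $ j) * (sqrt (x $ j) / sqrt (z $ j) * (?q $ j - ?t $ j)) = ?q $ j - ?t $ j"
        using pos[OF j] by simp
      finally show "(?t + dz) $ j = ?q $ j" using j dzc t by simp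
    qed (use dzc z in simp)
    fix i assume i: "i < n"
    have "sqrt a / sqrt d = a / sqrt (a * d)" if "0 < a" "0 < d" for a d :: real
      using that by (simp add: real_sqrt_mult real_div_sqrt field_simps)
    note sq = this[OF pos[OF i]] this[OF pos(2)[OF i] pos(1)[OF i]]
    show "dx $ i = x $ i * (du $ i / sqrt (x $ i * z $ i))"
    proof -
      have "dx $ i = sqrt (x $ i) / sqrt (z $ i) * du $ i" using i by (simp add: dx_vec)
      then show ?thesis unfolding sq(1) by simp
    qed
    show "dz $ i = z $ i * (dv $ i / sqrt (x $ i * z $ i))"
    proof -
      have "dz $ i = sqrt (z $ i) / sqrt (x $ i) * dv $ i" using i by (simp add: dz_vec)
      then show ?thesis unfolding sq(2) mult.commute[of "z $ i" "x $ i"] by simp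
    qed
    have "(du + dv) $ i = (r + \<xi>) $ i" using s by simp
    then show "du $ i + dv $ i
       = (- sqrt (x $ i * z $ i) + (x \<bullet> z) / (n + \<nu>) / sqrt (x $ i * z $ i)) + \<xi> $ i"
      using i du dv xi by (simp add: r_def \<mu>_def)
  next
    have rc: "r \<in> carrier_vec n" by (simp add: r_def)
    have "L2_set (\<lambda>i. r $ i) {0..<n}
        = L2_set (\<lambda>i. - sqrt (x $ i * z $ i) + (x \<bullet> z) / (n + \<nu>) / sqrt (x $ i * z $ i)) {0..<n}"
      by (rule L2_set_cong) (auto simp: r_def \<mu>_def)
    moreover have "r \<bullet> \<xi>
        = (\<Sum>i\<in>{0..<n}. (- sqrt (x $ i * z $ i) + (x \<bullet> z) / (n + \<nu>) / sqrt (x $ i * z $ i)) * \<xi> $ i)"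
      using xi by (simp add: scalar_prod_def r_def \<mu>_def)
    ultimately show "- (\<Sum>i\<in>{0..<n}. (- sqrt (x $ i * z $ i) + (x \<bullet> z) / (n + \<nu>) / sqrt (x $ i * z $ i)) * \<xi> $ i)
       \<le> \<kappa> * (L2_set (\<lambda>i. - sqrt (x $ i * z $ i) + (x \<bullet> z) / (n + \<nu>) / sqrt (x $ i * z $ i)) {0..<n})\<^sup>2"
      using r_xi unfolding eucl_norm_eq_L2_set[OF rc] by simp
    show "L2_set (\<lambda>i. \<xi> $ i) {0..<n} \<le> \<kappa> * min (L2_set (\<lambda>i. du $ i) {0..<n}) (L2_set (\<lambda>i. dv $ i) {0..<n})"
      using norm_xi by (simp add: eucl_norm_eq_L2_set[OF xi] eucl_norm_eq_L2_set[OF du] eucl_norm_eq_L2_set[OF dv])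
    have "w \<bullet> \<xi> = (\<Sum>i\<in>{0..<n}. sqrt (x $ i * z $ i) * \<xi> $ i)"
      using xi by (simp add: scalar_prod_def w_def)
    then show "- (\<Sum>i\<in>{0..<n}. sqrt (x $ i * z $ i) * \<xi> $ i) \<le> \<kappa> * (n / (n + \<nu>)) * (x \<bullet> z)"
      using w_xi ww by simp
  qed
qed


subsection \<open>The iterates\<close>

lemma potential_eq:
  "x \<in> carrier_vec n \<Longrightarrow> potential \<nu> x z
     = (real n + \<nu>) * ln (x \<bullet> z) - (\<Sum>i\<in>{0..<n}. ln (x $ i * z $ i)) - real n * ln (real n)"
  by (simp add: potential_def Let_def atLeast0LessThan)

locale potential_reduction =
  fixes m n :: nat and A :: rmat and b c :: rvec and \<rho> \<epsilon> \<nu> \<kappa> :: real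
  assumes n_pos: "0 < n" and A: "A \<in> carrier_mat m n" and full_rank: "vec_space.rank m A = m"
    and b: "b \<in> carrier_vec m" and c: "c \<in> carrier_vec n"
    and rho_pos: "0 < \<rho>" and eps_pos: "0 < \<epsilon>"
    and nu_lower: "sqrt (real n) \<le> \<nu>" and nu_upper: "\<nu> \<le> 2 * real n"
    and kappa_nonneg: "0 \<le> \<kappa>" and kappa_less_1: "\<kappa> < 1"
begin

abbreviation "x0 \<equiv> initial_x A \<rho>"
abbreviation "y0 \<equiv> initial_y A"
abbreviation "z0 \<equiv> initial_z A \<rho>"

text \<open>Along a run \<open>\<theta>\<close> is the product of the factors
  \<open>1 - \<alpha>\<close> of the steps taken; a configuration does not record it, so it is a
  parameter.\<close>

definition reduced_point :: "real \<Rightarrow> rvec \<Rightarrow> rvec \<Rightarrow> rvec \<Rightarrow> bool" where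
  "reduced_point \<theta> x y z \<longleftrightarrow> 0 \<le> \<theta> \<and> \<theta> \<le> 1 \<and>
     x \<in> carrier_vec n \<and> y \<in> carrier_vec m \<and> z \<in> carrier_vec n \<and> positive_vec x \<and> positive_vec z \<and>
     A *\<^sub>v x - b = \<theta> \<cdot>\<^sub>v (A *\<^sub>v x0 - b) \<and>
     transpose_mat A *\<^sub>v y + z - c = \<theta> \<cdot>\<^sub>v (transpose_mat A *\<^sub>v y0 + z0 - c) \<and>
     \<theta> * (x0 \<bullet> z0) \<le> x \<bullet> z"

lemma x0: "x0 = vec n (\<lambda>_. \<rho>)" and z0: "z0 = vec n (\<lambda>_. \<rho>)" and y0: "y0 = 0\<^sub>v m"
  using A by (auto simp: initial_x_def initial_z_def initial_y_def ones_def)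

lemma initial_gap: "x0 \<bullet> z0 = real n * \<rho>\<^sup>2"
  by (simp add: x0 z0 scalar_prod_def power2_eq_square)

lemma nu_ge_1: "1 \<le> \<nu>"
proof -
  have "sqrt 1 \<le> sqrt (real n)" using n_pos by (intro real_sqrt_le_mono) simp
  then show ?thesis using nu_lower unfolding real_sqrt_one by linarith
qed

lemma reduced_point_initial: "reduced_point 1 x0 y0 z0"
  unfolding reduced_point_def positive_vec_def using rho_pos by (simp add: x0 z0 y0)

text \<open>Read contrapositively, this is the claim about stopping in step 3. The witness is the
  \<open>\<alpha>\<close> of \<open>scaled_direction\<close>.\<close>

lemma step_size_exists:
  assumes red: "reduced_point \<theta> x y z"
    and dir: "search_direction A b c \<nu> \<kappa> x y z dx dy dz"
    and opt: "primal_optimal A b c xs" "dual_optimal A b c ys zs" and bound: "max_norm (xs @\<^sub>v zs) \<le> \<rho>"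
  shows "\<exists>\<alpha>. step_size \<nu> \<kappa> x z dx dz \<alpha>"
proof -
  have theta: "0 \<le> \<theta>" "\<theta> \<le> 1" and x: "x \<in> carrier_vec n" and y: "y \<in> carrier_vec m"
    and z: "z \<in> carrier_vec n" and px: "positive_vec x" and pz: "positive_vec z"
    and pres: "A *\<^sub>v x - b = \<theta> \<cdot>\<^sub>v (A *\<^sub>v x0 - b)"
    and dres: "transpose_mat A *\<^sub>v y + z - c = \<theta> \<cdot>\<^sub>v (transpose_mat A *\<^sub>v y0 + z0 - c)"
    and gap: "\<theta> * (x0 \<bullet> z0) \<le> x \<bullet> z"
    using red unfolding reduced_point_def by blast+
  have pos: "0 < x $ i" "0 < z $ i" if "i < n" for i
    using that x z px pz unfolding positive_vec_def by auto
  define w where "w i = sqrt (x $ i * z $ i)" for i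
  have w_pos: "0 < w i" if "i < n" for i using pos[OF that] by (simp add: w_def)
  have w2: "(w i)\<^sup>2 = x $ i * z $ i" if "i < n" for i using pos[OF that] by (simp add: w_def)
  interpret P: scaled_point "{0..<n}" w \<nu>
    using n_pos w_pos nu_lower nu_upper by unfold_locales auto
  have Pn: "P.n = real n" by (simp add: P.n_def)
  have Pgap: "P.gap = x \<bullet> z" using z by (simp add: P.gap_def scalar_prod_def w2)
  have Pmu: "P.\<mu> = (x \<bullet> z) / (n + \<nu>)" by (simp add: P.\<mu>_def Pn Pgap)
  have Pr: "P.r = (\<lambda>i. - w i + (x \<bullet> z) / (n + \<nu>) / w i)" by (simp add: P.r_def Pmu fun_eq_iff)
  obtain u v \<xi> :: rvec
  where dx: "dx \<in> carrier_vec n" and dy: "dy \<in> carrier_vec m" and dz: "dz \<in> carrier_vec n"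
    and Adx: "A *\<^sub>v dx = b - A *\<^sub>v x"
    and Atdy: "transpose_mat A *\<^sub>v dy + dz = c - transpose_mat A *\<^sub>v y - z"
    and dxu: "\<And>i. i < n \<Longrightarrow> dx $ i = x $ i * (u $ i / w i)"
    and dzv: "\<And>i. i < n \<Longrightarrow> dz $ i = z $ i * (v $ i / w i)"
    and uv: "\<And>i. i < n \<Longrightarrow> u $ i + v $ i = P.r i + \<xi> $ i"
    and r_xi: "- (\<Sum>i\<in>{0..<n}. P.r i * \<xi> $ i) \<le> \<kappa> * P.R\<^sup>2"
    and xi: "L2_set (\<lambda>i. \<xi> $ i) {0..<n} \<le> \<kappa> * min (L2_set (\<lambda>i. u $ i) {0..<n}) (L2_set (\<lambda>i. v $ i) {0..<n})"
    and w_xi: "- (\<Sum>i\<in>{0..<n}. w i * \<xi> $ i) \<le> \<kappa> * (P.n / (P.n + \<nu>)) * P.gap"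
  proof (rule search_directionE[OF A b c x px y z pz dir], goal_cases)
    case (1 u v \<xi>)
    show thesis
      by (rule that[OF 1(2-6)], unfold P.R_def Pr Pn Pgap w_def) (erule 1(7-9) | rule 1(10-12))+
  qed
  note p = primal_feasibleD[OF A opt(1)[unfolded primal_optimal_def, THEN conjunct1]]
  note d = dual_feasibleD[OF A opt(2)[unfolded dual_optimal_def, THEN conjunct1]]
  have index_le: "\<bar>(xs @\<^sub>v zs) $ i\<bar> \<le> \<rho>" if "i < n + n" for i
    using abs_index_le_max_norm[of i "xs @\<^sub>v zs"] bound that p(1) d(2) by simp
  have bounds: "\<bar>xs $ i\<bar> \<le> \<rho>" "\<bar>zs $ i\<bar> \<le> \<rho>" if "i < n" for i
    using index_le[of i] index_le[of "n + i"] that p(1) d(2) by simp_all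
  interpret F: infeasible_point "{0..<m}" "{0..<n}" "\<lambda>i j. A $$ (i, j)" "\<lambda>i. b $ i" "\<lambda>j. c $ j"
    "\<lambda>j. x $ j" "\<lambda>i. y $ i" "\<lambda>j. z $ j" "\<lambda>j. xs $ j" "\<lambda>i. ys $ i" "\<lambda>j. zs $ j" \<theta> \<rho>
  proof unfold_locales
    fix i assume "i \<in> {0..<m}"
    then have i: "i < m" by simp
    have "(A *\<^sub>v x - b) $ i = (\<theta> \<cdot>\<^sub>v (A *\<^sub>v x0 - b)) $ i" by (simp only: pres)
    then show "(\<Sum>j\<in>{0..<n}. A $$ (i, j) * x $ j) - b $ i = \<theta> * ((\<Sum>j\<in>{0..<n}. A $$ (i, j) * \<rho>) - b $ i)"
      using i A b x mult_mat_vec_index[OF A x i] mult_mat_vec_index[OF A _ i, of x0]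
      by (simp add: x0 del: index_mult_mat_vec)
    show "(\<Sum>j\<in>{0..<n}. A $$ (i, j) * xs $ j) = b $ i"
      using mult_mat_vec_index[OF A p(1) i] p(2) by simp
  next
    fix j assume "j \<in> {0..<n}"
    then have j: "j < n" by simp
    have "(transpose_mat A *\<^sub>v y + z - c) $ j = (\<theta> \<cdot>\<^sub>v (transpose_mat A *\<^sub>v y0 + z0 - c)) $ j"
      by (simp only: dres)
    then show "(\<Sum>i\<in>{0..<m}. A $$ (i, j) * y $ i) + z $ j - c $ j = \<theta> * (\<rho> - c $ j)"
      using j A c z transpose_mult_mat_vec_index[OF A y j]
        transpose_mult_mat_vec_index[OF A _ j, of y0]
      by (simp add: y0 z0 del: index_mult_mat_vec)
    have "(transpose_mat A *\<^sub>v ys + zs) $ j = c $ j" by (simp only: d(3))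
    then show "(\<Sum>i\<in>{0..<m}. A $$ (i, j) * ys $ i) + zs $ j = c $ j"
      using j d(2) transpose_mult_mat_vec_index[OF A d(1) j] by (simp del: index_mult_mat_vec)
    show "0 \<le> xs $ j \<and> xs $ j \<le> \<rho>" "0 \<le> zs $ j \<and> zs $ j \<le> \<rho>"
      using p(3)[OF j] d(4)[OF j] bounds[OF j] by auto
    show "xs $ j * zs $ j = 0" by (rule complementary_slackness[OF A c opt j])
    show "0 < x $ j" "0 < z $ j" using pos j by auto
  next
    show "\<theta> * (real (card {0..<n}) * \<rho>\<^sup>2) \<le> (\<Sum>j\<in>{0..<n}. x $ j * z $ j)"
      using gap z unfolding initial_gap by (simp add: scalar_prod_def)
  qed (fact theta)+
  \<comment> \<open>The offsets of \<open>newton_direction_orthogonal\<close> in scaled coordinates: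
    \<open>z $ j / w j\<close> is the diagonal entry of the inverse of \<open>D\<close>, and
    \<open>x $ j / w j\<close> that of \<open>D\<close>.\<close>
  define f where "f j = \<theta> * (\<rho> - xs $ j) * z $ j / w j" for j
  define g where "g j = \<theta> * (\<rho> - zs $ j) * x $ j / w j" for j
  have "(\<Sum>j\<in>{0..<n}. (dx $ j + \<theta> * (\<rho> - xs $ j)) * (dz $ j + \<theta> * (\<rho> - zs $ j))) = 0"
  proof (rule F.newton_direction_orthogonal)
    fix i assume "i \<in> {0..<m}"
    then have i: "i < m" by simp
    have "(A *\<^sub>v dx) $ i = (b - A *\<^sub>v x) $ i" by (simp only: Adx)
    then show "(\<Sum>j\<in>{0..<n}. A $$ (i, j) * dx $ j) = b $ i - (\<Sum>j\<in>{0..<n}. A $$ (i, j) * x $ j)"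
      using i A b mult_mat_vec_index[OF A x i] mult_mat_vec_index[OF A dx i]
      by (simp del: index_mult_mat_vec)
  next
    fix j assume "j \<in> {0..<n}"
    then have j: "j < n" by simp
    have "(transpose_mat A *\<^sub>v dy + dz) $ j = (c - transpose_mat A *\<^sub>v y - z) $ j" by (simp only: Atdy)
    then show "(\<Sum>i\<in>{0..<m}. A $$ (i, j) * dy $ i) + dz $ j
        = c $ j - (\<Sum>i\<in>{0..<m}. A $$ (i, j) * y $ i) - z $ j"
      using j A c z dz transpose_mult_mat_vec_index[OF A y j] transpose_mult_mat_vec_index[OF A dy j]
      by (simp del: index_mult_mat_vec)
  qed
  moreover have "(dx $ j + \<theta> * (\<rho> - xs $ j)) * (dz $ j + \<theta> * (\<rho> - zs $ j))
      = (u $ j + f j) * (v $ j + g j)" if "j \<in> {0..<n}" for j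
  proof -
    have j: "j < n" using that by simp
    have nz: "x $ j \<noteq> 0" "z $ j \<noteq> 0" "w j \<noteq> 0" using pos[OF j] w_pos[OF j] by auto
    have xz: "x $ j * z $ j / w j = w j" using w2[OF j] nz(3) by (simp add: power2_eq_square field_simps)
    have "u $ j = x $ j * z $ j / w j * (u $ j / w j)" using nz(3) by (simp add: xz)
    then have uf: "u $ j + f j = z $ j / w j * (dx $ j + \<theta> * (\<rho> - xs $ j))"
      by (simp add: f_def dxu[OF j] distrib_left mult_ac)
    have "v $ j = x $ j * z $ j / w j * (v $ j / w j)" using nz(3) by (simp add: xz)
    then have vg: "v $ j + g j = x $ j / w j * (dz $ j + \<theta> * (\<rho> - zs $ j))"
      by (simp add: g_def dzv[OF j] distrib_left mult_ac)
    \<comment> \<open>The opposite scalings of the primal and dual factors cancel, so orthogonality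
      survives.\<close>
    have one: "z $ j / w j * (x $ j / w j) = 1"
      using w2[OF j] nz by (simp add: power2_eq_square mult.commute)
    have "s * p * (t * q) = s * t * (p * q)" for s p t q :: real by simp
    then show ?thesis unfolding uf vg by (simp only: one mult_1)
  qed
  ultimately have orth: "(\<Sum>j\<in>{0..<n}. (u $ j + f j) * (v $ j + g j)) = 0" by simp
  then have orth': "(\<Sum>j\<in>{0..<n}. (v $ j + g j) * (u $ j + f j)) = 0" by (simp add: mult.commute)
  have fg: "0 \<le> f j \<and> 0 \<le> g j" if "j \<in> {0..<n}" for j
    using that F.xs_bounds[OF that] F.zs_bounds[OF that] theta(1) pos[of j] w_pos[of j]
    by (simp add: f_def g_def)
  have "f j * w j + g j * w j = \<theta> * (\<rho> - xs $ j) * z $ j + \<theta> * (\<rho> - zs $ j) * x $ j"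
    if "j \<in> {0..<n}" for j
    using that w_pos[of j] by (simp add: f_def g_def)
  then have dist: "(\<Sum>j\<in>{0..<n}. f j * w j + g j * w j) \<le> 2 * P.gap"
    using F.scaled_distance_bound by (simp add: P.gap_def w2)
  have dist': "(\<Sum>j\<in>{0..<n}. g j * w j + f j * w j) \<le> 2 * P.gap"
    using dist by (simp add: add.commute)
  have xi_u: "L2_set (\<lambda>i. \<xi> $ i) {0..<n} \<le> \<kappa> * L2_set (\<lambda>i. u $ i) {0..<n}"
    and xi_v: "L2_set (\<lambda>i. \<xi> $ i) {0..<n} \<le> \<kappa> * L2_set (\<lambda>i. v $ i) {0..<n}"
    using order_trans[OF xi mult_left_mono[OF min.cobounded1 kappa_nonneg]]
      order_trans[OF xi mult_left_mono[OF min.cobounded2 kappa_nonneg]] .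
  interpret S: scaled_direction "{0..<n}" w \<nu> \<kappa> "\<lambda>i. u $ i" "\<lambda>i. v $ i" "\<lambda>i. \<xi> $ i"
  proof unfold_locales
    show "L2_set (\<lambda>i. u $ i) {0..<n} \<le> 3 * (P.n + \<nu>) / (1 - \<kappa>) * P.R"
      using uv by (intro P.newton_direction_bound[OF orth fg dist _ xi_u kappa_less_1]) auto
    show "L2_set (\<lambda>i. v $ i) {0..<n} \<le> 3 * (P.n + \<nu>) / (1 - \<kappa>) * P.R"
      using uv fg
      by (intro P.newton_direction_bound[OF orth' _ dist' _ xi_v kappa_less_1]) (auto simp: add.commute)
  qed (simp_all only: kappa_nonneg kappa_less_1 uv r_xi w_xi atLeastLessThan_iff)
  define x' where "x' = x + S.\<alpha> \<cdot>\<^sub>v dx"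
  define z' where "z' = z + S.\<alpha> \<cdot>\<^sub>v dz"
  have x': "x' \<in> carrier_vec n" and z': "z' \<in> carrier_vec n"
    using x z dx dz by (auto simp: x'_def z'_def)
  have x'i: "x' $ i = x $ i * (1 + S.\<alpha> * u $ i / w i)"
    and z'i: "z' $ i = z $ i * (1 + S.\<alpha> * v $ i / w i)" if "i < n" for i
    using that x z dx dz by (simp_all add: x'_def z'_def dxu dzv algebra_simps)
  have fac: "0 < 1 + S.\<alpha> * u $ i / w i" "0 < 1 + S.\<alpha> * v $ i / w i" if "i < n" for i
    using that S.factors_pos[of i] by auto
  have gap': "x' \<bullet> z' = S.new_gap"
    using z' unfolding S.new_gap_def scalar_prod_def
    by (intro sum.cong) (auto simp: x'i z'i w2 mult_ac)
  have "(\<Sum>i\<in>{0..<n}. ln (x' $ i * z' $ i)) = (\<Sum>i\<in>{0..<n}. ln (x $ i * z $ i)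
      + ln (1 + S.\<alpha> * u $ i / w i) + ln (1 + S.\<alpha> * v $ i / w i))"
  proof (rule sum.cong[OF refl])
    fix i assume "i \<in> {0..<n}"
    then have i: "i < n" by simp
    have "x' $ i * z' $ i
        = (x $ i * z $ i) * (1 + S.\<alpha> * u $ i / w i) * (1 + S.\<alpha> * v $ i / w i)"
      by (simp only: x'i[OF i] z'i[OF i] mult_ac)
    moreover have "0 < x $ i * z $ i" using pos[OF i] by simp
    ultimately show "ln (x' $ i * z' $ i)
        = ln (x $ i * z $ i) + ln (1 + S.\<alpha> * u $ i / w i) + ln (1 + S.\<alpha> * v $ i / w i)"
      using fac[OF i] by (simp only: ln_mult_pos mult_pos_pos)
  qed
  then have "potential \<nu> x' z' \<le> potential \<nu> x z - (1 - \<kappa>) ^ 4 / (1600 * (real n + \<nu>)\<^sup>2)"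
    using S.potential_decrease
    unfolding potential_eq[OF x] potential_eq[OF x'] gap' Pn Pgap[symmetric]
    by (simp only: sum.distrib)
  moreover have "positive_vec x'" "positive_vec z'"
    unfolding positive_vec_def using x' z' fac pos by (auto simp: x'i z'i)
  ultimately have "step_size \<nu> \<kappa> x z dx dz S.\<alpha>"
    unfolding step_size_def Let_def x'_def[symmetric] z'_def[symmetric]
    using x S.alpha_pos S.alpha_le_1 S.new_gap_lower by (simp add: gap' Pgap)
  then show ?thesis by blast
qed

end


subsection \<open>Termination\<close>

text \<open>The inequality of arithmetic and geometric means, from the tangent
  \<open>ln s \<le> s - 1\<close> at each term divided by the mean.\<close>

lemma sum_ln_le:
  fixes t :: "'i \<Rightarrow> real"
  assumes "finite I" "I \<noteq> {}" and pos: "\<And>i. i \<in> I \<Longrightarrow> 0 < t i"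
  shows "(\<Sum>i\<in>I. ln (t i)) \<le> card I * (ln (\<Sum>i\<in>I. t i) - ln (card I))"
proof -
  define S where "S = (\<Sum>i\<in>I. t i)"
  define N where "N = real (card I)"
  have N: "0 < N" unfolding N_def using assms by (simp add: card_gt_0_iff)
  have S: "0 < S" unfolding S_def using assms by (intro sum_pos) auto
  have "ln (t i) \<le> t i * (N / S) - 1 + (ln S - ln N)" if "i \<in> I" for i
  proof -
    have "ln (t i * (N / S)) \<le> t i * (N / S) - 1"
      using pos[OF that] N S by (intro ln_le_minus_one) simp
    moreover have "ln (t i * (N / S)) = ln (t i) + (ln N - ln S)"
      using pos[OF that] N S by (simp add: ln_mult_pos ln_div)
    ultimately show ?thesis by linarith
  qed
  then have "(\<Sum>i\<in>I. ln (t i)) \<le> (\<Sum>i\<in>I. t i * (N / S) - 1 + (ln S - ln N))"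
    by (rule sum_mono)
  also have "\<dots> = (\<Sum>i\<in>I. t i * (N / S)) - N + N * (ln S - ln N)"
    by (simp add: sum.distrib sum_subtractf N_def)
  also have "(\<Sum>i\<in>I. t i * (N / S)) = S * (N / S)"
    unfolding S_def by (rule sum_distrib_right[symmetric])
  finally have "(\<Sum>i\<in>I. ln (t i)) \<le> N * (ln S - ln N)" using S by simp
  then show ?thesis by (simp only: S_def N_def)
qed

section \<open>Potential, invariants and stopping of the runs\<close>

context potential_reduction
begin

definition "\<delta> = (1 - \<kappa>) ^ 4 / (1600 * (real n + \<nu>)\<^sup>2)"

lemma delta_pos: "0 < \<delta>"
  using kappa_less_1 nu_ge_1 by (simp add: \<delta>_def)

lemma gap_pos:
  assumes "x \<in> carrier_vec n" "z \<in> carrier_vec n" "positive_vec x" "positive_vec z"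
  shows "0 < x \<bullet> z"
  using assms n_pos unfolding scalar_prod_def positive_vec_def by (intro sum_pos) auto

lemma potential_ge:
  assumes x: "x \<in> carrier_vec n" "positive_vec x" and z: "z \<in> carrier_vec n" "positive_vec z"
  shows "\<nu> * ln (x \<bullet> z) \<le> potential \<nu> x z"
proof -
  have "(\<Sum>i\<in>{0..<n}. ln (x $ i * z $ i)) \<le> n * (ln (x \<bullet> z) - ln n)"
    using sum_ln_le[of "{0..<n}" "\<lambda>i. x $ i * z $ i"] n_pos x z
    unfolding scalar_prod_def positive_vec_def by simp
  then show ?thesis unfolding potential_eq[OF x(1)] by (simp add: algebra_simps)
qed

text \<open>All initial products are equal, so the bound of \<open>potential_ge\<close> is
  attained.\<close>

lemma potential_initial: "potential \<nu> x0 z0 = \<nu> * (ln n + 2 * ln \<rho>)"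
proof -
  have x0c: "x0 \<in> carrier_vec n" by (simp add: x0)
  have "(\<Sum>i\<in>{0..<n}. ln (x0 $ i * z0 $ i)) = n * (2 * ln \<rho>)"
    using rho_pos by (simp add: x0 z0 ln_mult_pos)
  moreover have "ln (x0 \<bullet> z0) = ln n + 2 * ln \<rho>"
    unfolding initial_gap using n_pos rho_pos by (simp add: ln_mult_pos ln_realpow)
  ultimately show ?thesis unfolding potential_eq[OF x0c] by (simp add: algebra_simps)
qed

text \<open>The exact Newton solution qualifies: with \<open>\<xi> = 0\<close> conditions (a) to (c)
  compare 0 with nonnegative numbers.\<close>

lemma search_direction_exists:
  assumes red: "reduced_point \<theta> x y z"
  shows "\<exists>dx dy dz. search_direction A b c \<nu> \<kappa> x y z dx dy dz"
proof -
  have x: "x \<in> carrier_vec n" "positive_vec x" and y: "y \<in> carrier_vec m"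
    and z: "z \<in> carrier_vec n" "positive_vec z"
    using red unfolding reduced_point_def by blast+
  define \<mu> where "\<mu> = (x \<bullet> z) / (n + \<nu>)"
  obtain du dy dv where sol: "newton_solution A b c \<mu> x y z (0\<^sub>v n) du dy dv"
    using newton_solution_exists[OF A full_rank b c x y z] by blast
  have "eucl_norm (0\<^sub>v n) = 0" by (simp add: eucl_norm_def)
  moreover have "0 \<le> eucl_norm v" for v by (simp add: eucl_norm_eq_L2_set[OF carrier_vec_dim_vec])
  moreover have "vec_r \<mu> x z \<in> carrier_vec n" "vec_w x z \<in> carrier_vec n"
    using x by (auto simp: vec_r_def vec_w_def scal_W_def scal_W_inv_def ones_def mat_diag_mult_vec)
  ultimately have "- (vec_r \<mu> x z \<bullet> 0\<^sub>v n) \<le> \<kappa> * (eucl_norm (vec_r \<mu> x z))\<^sup>2"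
    "eucl_norm (0\<^sub>v n) \<le> \<kappa> * min (eucl_norm du) (eucl_norm dv)"
    "- (vec_w x z \<bullet> 0\<^sub>v n) \<le> \<kappa> * (n / (n + \<nu>)) * (eucl_norm (vec_w x z))\<^sup>2"
    using kappa_nonneg nu_ge_1 by simp_all
  then show ?thesis
    unfolding search_direction_def Let_def carrier_matD(2)[OF A] \<mu>_def[symmetric]
    by (intro exI[of _ "scal_D x z *\<^sub>v du"] exI[of _ dy] exI[of _ "scal_D_inv x z *\<^sub>v dv"]
        exI[of _ "0\<^sub>v n"] exI[of _ du] exI[of _ dv] conjI refl sol zero_carrier_vec)
qed

text \<open>The residual \<open>\<xi>\<close> perturbs only the third Newton equation. Both
  feasibility equations are solved exactly, so the infeasibilities shrink by exactly
  \<open>1 - \<alpha>\<close>.\<close>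

lemma reduced_point_update:
  assumes red: "reduced_point \<theta> x y z"
    and dir: "search_direction A b c \<nu> \<kappa> x y z dx dy dz"
    and step: "step_size \<nu> \<kappa> x z dx dz \<alpha>"
  shows "reduced_point ((1 - \<alpha>) * \<theta>) (x + \<alpha> \<cdot>\<^sub>v dx) (y + \<alpha> \<cdot>\<^sub>v dy) (z + \<alpha> \<cdot>\<^sub>v dz)"
proof -
  have theta: "0 \<le> \<theta>" "\<theta> \<le> 1" and x: "x \<in> carrier_vec n" and y: "y \<in> carrier_vec m"
    and z: "z \<in> carrier_vec n" and px: "positive_vec x" and pz: "positive_vec z"
    and pres: "A *\<^sub>v x - b = \<theta> \<cdot>\<^sub>v (A *\<^sub>v x0 - b)"
    and dres: "transpose_mat A *\<^sub>v y + z - c = \<theta> \<cdot>\<^sub>v (transpose_mat A *\<^sub>v y0 + z0 - c)"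
    and gap: "\<theta> * (x0 \<bullet> z0) \<le> x \<bullet> z"
    using red unfolding reduced_point_def by blast+
  have alpha: "0 < \<alpha>" "\<alpha> \<le> 1" and px': "positive_vec (x + \<alpha> \<cdot>\<^sub>v dx)" and pz': "positive_vec (z + \<alpha> \<cdot>\<^sub>v dz)"
    and gap': "(1 - \<alpha>) * (x \<bullet> z) \<le> (x + \<alpha> \<cdot>\<^sub>v dx) \<bullet> (z + \<alpha> \<cdot>\<^sub>v dz)"
    using step unfolding step_size_def Let_def by blast+
  have dirs: "dx \<in> carrier_vec n \<and> dy \<in> carrier_vec m \<and> dz \<in> carrier_vec n \<and>
      A *\<^sub>v dx = b - A *\<^sub>v x \<and> transpose_mat A *\<^sub>v dy + dz = c - transpose_mat A *\<^sub>v y - z"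
    by (rule search_directionE[OF A b c x px y z pz dir]) (intro conjI)
  then have dx: "dx \<in> carrier_vec n" and dy: "dy \<in> carrier_vec m" and dz: "dz \<in> carrier_vec n"
    and Adx: "A *\<^sub>v dx = b - A *\<^sub>v x"
    and Atdy: "transpose_mat A *\<^sub>v dy + dz = c - transpose_mat A *\<^sub>v y - z" by blast+
  have AT: "transpose_mat A \<in> carrier_mat n m" using A by simp
  have Ax: "A *\<^sub>v x \<in> carrier_vec m" using A x by simp
  have Aty: "transpose_mat A *\<^sub>v y \<in> carrier_vec n" using AT y by simp
  have Atdyc: "transpose_mat A *\<^sub>v dy \<in> carrier_vec n" using AT dy by simp
  have "A *\<^sub>v (x + \<alpha> \<cdot>\<^sub>v dx) - b = (1 - \<alpha>) \<cdot>\<^sub>v (A *\<^sub>v x - b)"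
    unfolding mult_mat_vec_step[OF A x dx] Adx using A Ax b
    by (intro eq_vecI) (auto simp del: index_mult_mat_vec simp: algebra_simps)
  then have 1: "A *\<^sub>v (x + \<alpha> \<cdot>\<^sub>v dx) - b = ((1 - \<alpha>) * \<theta>) \<cdot>\<^sub>v (A *\<^sub>v x0 - b)"
    unfolding pres by (simp only: smult_smult_assoc)
  have "transpose_mat A *\<^sub>v (y + \<alpha> \<cdot>\<^sub>v dy) + (z + \<alpha> \<cdot>\<^sub>v dz) - c
      = (transpose_mat A *\<^sub>v y + z - c) + \<alpha> \<cdot>\<^sub>v (transpose_mat A *\<^sub>v dy + dz)"
    unfolding mult_mat_vec_step[OF AT y dy] using A Aty Atdyc z dz c
    by (intro eq_vecI) (auto simp del: index_mult_mat_vec simp: algebra_simps)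
  also have "\<dots> = (1 - \<alpha>) \<cdot>\<^sub>v (transpose_mat A *\<^sub>v y + z - c)"
    unfolding Atdy using A Aty z c
    by (intro eq_vecI) (auto simp del: index_mult_mat_vec simp: algebra_simps)
  finally have 2: "transpose_mat A *\<^sub>v (y + \<alpha> \<cdot>\<^sub>v dy) + (z + \<alpha> \<cdot>\<^sub>v dz) - c
      = ((1 - \<alpha>) * \<theta>) \<cdot>\<^sub>v (transpose_mat A *\<^sub>v y0 + z0 - c)"
    unfolding dres by (simp only: smult_smult_assoc)
  have "(1 - \<alpha>) * (\<theta> * (x0 \<bullet> z0)) \<le> (1 - \<alpha>) * (x \<bullet> z)"
    using gap alpha by (intro mult_left_mono) auto
  then have 3: "(1 - \<alpha>) * \<theta> * (x0 \<bullet> z0) \<le> (x + \<alpha> \<cdot>\<^sub>v dx) \<bullet> (z + \<alpha> \<cdot>\<^sub>v dz)"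
    using gap' by (simp only: mult.assoc order_trans)
  have 4: "0 \<le> (1 - \<alpha>) * \<theta>" "(1 - \<alpha>) * \<theta> \<le> 1"
    using alpha theta by (simp_all add: mult_le_one)
  have 5: "x + \<alpha> \<cdot>\<^sub>v dx \<in> carrier_vec n" "y + \<alpha> \<cdot>\<^sub>v dy \<in> carrier_vec m" "z + \<alpha> \<cdot>\<^sub>v dz \<in> carrier_vec n"
    using x y z dx dy dz by simp_all
  show ?thesis unfolding reduced_point_def by (intro conjI 1 2 3 4 5 px' pz')
qed

text \<open>The gap dominates \<open>\<theta>\<close> times the initial gap, so a gap of at most
  \<open>\<epsilon>\<close> bounds \<open>\<theta>\<close> and with it the residual norm.\<close>

lemma approximate_solution_if_small_gap:
  assumes red: "reduced_point \<theta> x y z" and small: "x \<bullet> z \<le> \<epsilon>"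
  shows "approximate_solution A b c \<rho> \<epsilon> x y z"
proof -
  have theta: "0 \<le> \<theta>" and x: "x \<in> carrier_vec n" and y: "y \<in> carrier_vec m" and z: "z \<in> carrier_vec n"
    and pres: "A *\<^sub>v x - b = \<theta> \<cdot>\<^sub>v (A *\<^sub>v x0 - b)"
    and dres: "transpose_mat A *\<^sub>v y + z - c = \<theta> \<cdot>\<^sub>v (transpose_mat A *\<^sub>v y0 + z0 - c)"
    and gap: "\<theta> * (x0 \<bullet> z0) \<le> x \<bullet> z"
    using red unfolding reduced_point_def by blast+
  have gap0: "0 < x0 \<bullet> z0" unfolding initial_gap using n_pos rho_pos by simp
  have "residual_norm A b c x y z = \<theta> * residual_norm A b c x0 y0 z0"
  proof -
    have "(\<theta> \<cdot>\<^sub>v u) @\<^sub>v (\<theta> \<cdot>\<^sub>v v) = \<theta> \<cdot>\<^sub>v (u @\<^sub>v v)" for u v :: rvec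
      by (intro eq_vecI) auto
    then show ?thesis unfolding residual_norm_def pres dres by (simp only: eucl_norm_smult[OF theta])
  qed
  moreover have "\<theta> \<le> \<epsilon> / (x0 \<bullet> z0)"
    using gap small gap0 by (simp add: pos_le_divide_eq)
  moreover have "0 \<le> residual_norm A b c x0 y0 z0"
    by (simp add: residual_norm_def eucl_norm_eq_L2_set[OF carrier_vec_dim_vec])
  ultimately have "residual_norm A b c x y z \<le> \<epsilon> / (x0 \<bullet> z0) * residual_norm A b c x0 y0 z0"
    by (simp only: mult_right_mono)
  then show ?thesis using small by (simp add: approximate_solution_def)
qed

text \<open>The last conjunct counts \<open>k - 1\<close> because the gap is known to exceed
  \<open>\<epsilon>\<close> only before the most recent update; the current gap may already be
  smaller, and then the potential has no such lower bound.\<close>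

definition iterate :: "nat \<Rightarrow> rvec \<Rightarrow> rvec \<Rightarrow> rvec \<Rightarrow> bool" where
  "iterate k x y z \<longleftrightarrow> (\<exists>\<theta>. reduced_point \<theta> x y z) \<and>
     potential \<nu> x z \<le> potential \<nu> x0 z0 - k * \<delta> \<and>
     (0 < k \<longrightarrow> (real k - 1) * \<delta> \<le> \<nu> * (ln n + 2 * ln \<rho> - ln \<epsilon>))"

lemma iterate_initial: "iterate 0 x0 y0 z0"
  unfolding iterate_def using reduced_point_initial by auto

lemma iterate_update:
  assumes it: "iterate k x y z" and large: "\<not> x \<bullet> z \<le> \<epsilon>"
    and dir: "search_direction A b c \<nu> \<kappa> x y z dx dy dz"
    and step: "step_size \<nu> \<kappa> x z dx dz \<alpha>"
  shows "iterate (Suc k) (x + \<alpha> \<cdot>\<^sub>v dx) (y + \<alpha> \<cdot>\<^sub>v dy) (z + \<alpha> \<cdot>\<^sub>v dz)"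
proof -
  obtain \<theta> where red: "reduced_point \<theta> x y z" and pot: "potential \<nu> x z \<le> potential \<nu> x0 z0 - k * \<delta>"
    using it unfolding iterate_def by blast
  have x: "x \<in> carrier_vec n" "positive_vec x" and z: "z \<in> carrier_vec n" "positive_vec z"
    using red unfolding reduced_point_def by blast+
  have "\<nu> * ln \<epsilon> \<le> \<nu> * ln (x \<bullet> z)" using large eps_pos nu_ge_1 by simp
  then have "real k * \<delta> \<le> potential \<nu> x0 z0 - \<nu> * ln \<epsilon>"
    using potential_ge[OF x z] pot by linarith
  then have 1: "(real (Suc k) - 1) * \<delta> \<le> \<nu> * (ln n + 2 * ln \<rho> - ln \<epsilon>)"
    unfolding potential_initial right_diff_distrib[of \<nu> _ "ln \<epsilon>"] by simp
  have "potential \<nu> (x + \<alpha> \<cdot>\<^sub>v dx) (z + \<alpha> \<cdot>\<^sub>v dz) \<le> potential \<nu> x z - \<delta>"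
    using step x unfolding step_size_def Let_def \<delta>_def by simp
  then have 2: "potential \<nu> (x + \<alpha> \<cdot>\<^sub>v dx) (z + \<alpha> \<cdot>\<^sub>v dz) \<le> potential \<nu> x0 z0 - Suc k * \<delta>"
    using pot by (simp add: distrib_right)
  show ?thesis
    unfolding iterate_def using reduced_point_update[OF red dir step] 1 2 by blast
qed

text \<open>An iteration takes two transitions, hence \<open>2 * k\<close> and
  \<open>2 * k + 1\<close>. After stopping, \<open>t\<close> is unconstrained since the run stays
  put. The direction tried in step 3 is quantified because the stopped configuration forgets
  it.\<close>

definition run_invariant :: "nat \<Rightarrow> config \<Rightarrow> bool" where
  "run_invariant t s \<longleftrightarrow> (\<exists>k x y z. iterate k x y z \<and>
     (s = AtStep1 k x y z \<and> t = 2 * k \<or>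
      (\<exists>dx dy dz. search_direction A b c \<nu> \<kappa> x y z dx dy dz \<and>
         (s = AtStep3 k x y z dx dy dz \<and> \<not> x \<bullet> z \<le> \<epsilon> \<and> t = 2 * k + 1 \<or>
          s = StoppedInStep3 k x y z \<and> (\<nexists>\<alpha>. step_size \<nu> \<kappa> x z dx dz \<alpha>))) \<or>
      s = StoppedInStep1 k x y z \<and> x \<bullet> z \<le> \<epsilon>))"

lemma run_invariant_transition:
  assumes inv: "run_invariant t s" and tr: "transition A b c \<epsilon> \<nu> \<kappa> s s'"
  shows "run_invariant (Suc t) s'"
  using tr
proof cases
  case (stop1 x z k y)
  then show ?thesis using inv unfolding run_invariant_def by auto
next
  case (direction x z y dx dy dz k)
  then show ?thesis using inv unfolding run_invariant_def by auto
next
  case (stop3 x z dx dz k y dy)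
  then have "iterate k x y z" "search_direction A b c \<nu> \<kappa> x y z dx dy dz"
    using inv unfolding run_invariant_def by auto
  then show ?thesis using stop3(2,3) unfolding run_invariant_def by blast
next
  case (update x z dx dz \<alpha> k y dy)
  then have "iterate k x y z" "search_direction A b c \<nu> \<kappa> x y z dx dy dz" "\<not> x \<bullet> z \<le> \<epsilon>" "t = 2 * k + 1"
    using inv unfolding run_invariant_def by auto
  then show ?thesis
    using iterate_update[OF _ _ _ update(3)] update(2) unfolding run_invariant_def by auto
qed

text \<open>Step 1 always finds a direction, by full row rank, and step 3 either finds a step size
  or stops.\<close>

lemma no_deadlock:
  assumes "run_invariant t s" and "\<nexists>s'. transition A b c \<epsilon> \<nu> \<kappa> s s'"
  shows "(\<exists>k x y z. s = StoppedInStep1 k x y z) \<or> (\<exists>k x y z. s = StoppedInStep3 k x y z)"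
proof (cases s)
  case (AtStep1 k x y z)
  then have "iterate k x y z" using assms(1) unfolding run_invariant_def by auto
  then obtain dx dy dz where "search_direction A b c \<nu> \<kappa> x y z dx dy dz"
    using search_direction_exists unfolding iterate_def by blast
  then have "\<exists>s'. transition A b c \<epsilon> \<nu> \<kappa> s s'"
    using transition.stop1[of x z \<epsilon>] transition.direction[of x z \<epsilon>] unfolding AtStep1 by metis
  then show ?thesis using assms(2) by blast
next
  case (AtStep3 k x y z dx dy dz)
  have "\<exists>s'. transition A b c \<epsilon> \<nu> \<kappa> s s'"
    using transition.stop3[of \<nu> \<kappa> x z dx dz] transition.update[of \<nu> \<kappa> x z dx dz]
    unfolding AtStep3 by metis
  then show ?thesis using assms(2) by blast
qed auto

lemma complete_run_invariant:
  assumes run: "complete_run A b c \<rho> \<epsilon> \<nu> \<kappa> s"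
  shows "run_invariant t (s t)"
proof (induction t)
  case 0
  have "s 0 = AtStep1 0 x0 y0 z0" using run unfolding complete_run_def by blast
  then show ?case unfolding run_invariant_def using iterate_initial by auto
next
  case (Suc t)
  consider "transition A b c \<epsilon> \<nu> \<kappa> (s t) (s (Suc t))"
    | "s (Suc t) = s t" "\<nexists>s'. transition A b c \<epsilon> \<nu> \<kappa> (s t) s'"
    using run unfolding complete_run_def by blast
  then show ?case
  proof cases
    case 1
    then show ?thesis using run_invariant_transition[OF Suc.IH] by blast
  next
    case 2
    \<comment> \<open>For stopped configurations the invariant does not mention \<open>t\<close>, so
      it carries over to \<open>Suc t\<close>.\<close>
    show ?thesis
      using no_deadlock[OF Suc.IH 2(2)] Suc.IH unfolding 2(1) run_invariant_def
      by (elim disjE exE) (simp; blast)+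
  qed
qed

text \<open>A crude bound for a fixed instance that serves only to show that the run stops. The
  absolute value also covers \<open>k = 0\<close>, where the quantity may be negative.\<close>

lemma iterate_bound:
  assumes "iterate k x y z"
  shows "real k \<le> 1 + \<bar>\<nu> * (ln n + 2 * ln \<rho> - ln \<epsilon>)\<bar> / \<delta>"
proof (cases "0 < k")
  case True
  then have "(real k - 1) * \<delta> \<le> \<bar>\<nu> * (ln n + 2 * ln \<rho> - ln \<epsilon>)\<bar>"
    using assms unfolding iterate_def by (meson abs_ge_self order_trans)
  then have "real k - 1 \<le> \<bar>\<nu> * (ln n + 2 * ln \<rho> - ln \<epsilon>)\<bar> / \<delta>"
    by (simp only: pos_le_divide_eq[OF delta_pos])
  then show ?thesis by linarith
qed (use delta_pos in simp)

lemma complete_run_stops: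
  assumes run: "complete_run A b c \<rho> \<epsilon> \<nu> \<kappa> s"
  shows "\<exists>t k x y z. iterate k x y z \<and>
    (s t = StoppedInStep1 k x y z \<and> approximate_solution A b c \<rho> \<epsilon> x y z \<or>
     s t = StoppedInStep3 k x y z \<and>
     \<not> (\<exists>x' y' z'. primal_optimal A b c x' \<and> dual_optimal A b c y' z' \<and> max_norm (x' @\<^sub>v z') \<le> \<rho>))"
proof -
  obtain K :: nat where K: "1 + \<bar>\<nu> * (ln n + 2 * ln \<rho> - ln \<epsilon>)\<bar> / \<delta> \<le> real K"
    using real_arch_simple by blast
  \<comment> \<open>This exceeds \<open>2 * k + 1\<close> for every \<open>k \<le> K\<close>, so
    neither active configuration is possible at time \<open>t\<close>.\<close>
  define t where "t = 2 * K + 2"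
  obtain k x y z where it: "iterate k x y z"
    and s: "s t = AtStep1 k x y z \<and> t = 2 * k \<or>
      (\<exists>dx dy dz. search_direction A b c \<nu> \<kappa> x y z dx dy dz \<and>
         (s t = AtStep3 k x y z dx dy dz \<and> \<not> x \<bullet> z \<le> \<epsilon> \<and> t = 2 * k + 1 \<or>
          s t = StoppedInStep3 k x y z \<and> (\<nexists>\<alpha>. step_size \<nu> \<kappa> x z dx dz \<alpha>))) \<or>
      s t = StoppedInStep1 k x y z \<and> x \<bullet> z \<le> \<epsilon>"
    using complete_run_invariant[OF run, of t] unfolding run_invariant_def by blast
  have "real k \<le> real K" using iterate_bound[OF it] K by linarith
  then have "2 * k + 1 < t" by (simp add: t_def)
  then consider "s t = StoppedInStep1 k x y z" "x \<bullet> z \<le> \<epsilon>"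
    | dx dy dz where "s t = StoppedInStep3 k x y z" "search_direction A b c \<nu> \<kappa> x y z dx dy dz"
        "\<nexists>\<alpha>. step_size \<nu> \<kappa> x z dx dz \<alpha>"
    using s by fastforce
  moreover obtain \<theta> where red: "reduced_point \<theta> x y z" using it unfolding iterate_def by blast
  ultimately show ?thesis
    using it approximate_solution_if_small_gap[OF red] step_size_exists[OF red] by metis
qed

end

text \<open>\<open>ln \<rho> \<le> \<rho>\<close> makes the logarithmic terms \<open>O(L)\<close>,
  which settles \<open>k - 1\<close>. The rest of the proof finds a lower bound \<open>L0\<close>
  for \<open>L\<close>, depending only on \<open>C1\<close> and \<open>C2\<close>, that absorbs the
  missing 1.\<close>

lemma iteration_count_le:
  fixes \<kappa> C1 C2 :: real
  assumes "\<kappa> < 1"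
  shows "\<exists>C\<ge>0. \<forall>n \<rho> \<epsilon> \<nu> L k. 1 \<le> (n::nat) \<longrightarrow> 0 < \<rho> \<longrightarrow> 0 < \<epsilon> \<longrightarrow> 1 \<le> \<nu> \<longrightarrow>
    ln (real n) \<le> L \<longrightarrow> \<rho> \<le> C1 * L \<longrightarrow> ln (1 / \<epsilon>) \<le> C2 * L \<longrightarrow> 1 \<le> k \<longrightarrow>
    (k - 1) * ((1 - \<kappa>) ^ 4 / (1600 * (real n + \<nu>)\<^sup>2)) \<le> \<nu> * (ln n + 2 * ln \<rho> - ln \<epsilon>) \<longrightarrow>
    k \<le> C * (\<nu> * (real n + \<nu>)\<^sup>2 * L)"
proof -
  define L0 where "L0 = min (ln 2) (exp (- \<bar>C2\<bar> / 2) / (\<bar>C1\<bar> + 1))"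
  have L0: "0 < L0" by (simp add: L0_def)
  define q where "q = (1 - \<kappa>) ^ 4"
  have q: "0 < q" using assms by (simp add: q_def)
  define C where "C = 1 / L0 + 1600 / q * (1 + 2 * \<bar>C1\<bar> + \<bar>C2\<bar>)"
  have C: "0 \<le> C" using L0 q by (simp add: C_def)
  have "k \<le> C * (\<nu> * (real n + \<nu>)\<^sup>2 * L)"
    if n: "1 \<le> n" and rho: "0 < \<rho>" and eps: "0 < \<epsilon>" and nu: "1 \<le> \<nu>" and nL: "ln (real n) \<le> L"
      and rhoL: "\<rho> \<le> C1 * L" and epsL: "ln (1 / \<epsilon>) \<le> C2 * L" and k: "1 \<le> k"
      and le: "(k - 1) * (q / (1600 * (real n + \<nu>)\<^sup>2)) \<le> \<nu> * (ln n + 2 * ln \<rho> - ln \<epsilon>)"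
    for n :: nat and \<rho> \<epsilon> \<nu> L k :: real
  proof -
    have "0 \<le> ln (real n)" using n by simp
    then have Lnn: "0 \<le> L" using nL by linarith
    moreover have "L \<noteq> 0" using rho rhoL by auto
    ultimately have L: "0 < L" by simp
    then have C1: "0 < C1" using rho rhoL by (meson less_le_trans zero_less_mult_pos2)
    have le_eps: "- ln \<epsilon> \<le> \<bar>C2\<bar> * L"
      using epsL eps mult_right_mono[OF abs_ge_self[of C2] Lnn] by (simp add: ln_div)
    have "L0 \<le> L"
    proof (cases "n = 1 \<and> L < 1")
      case False
      have "ln 2 \<le> L"
      proof (cases "n = 1")
        case True
        then have "1 \<le> L" using False by simp
        then show ?thesis using ln_le_minus_one[of 2] by simp
      next
        case False
        then have "ln 2 \<le> ln (real n)" using n by simp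
        then show ?thesis using nL by linarith
      qed
      then show ?thesis by (simp add: L0_def)
    next
      \<comment> \<open>Here \<open>ln n = 0\<close> gives no lower bound. But
        \<open>k \<ge> 1\<close> forces \<open>2 * ln \<rho> \<ge> ln \<epsilon>\<close>, so
        \<open>\<rho>\<close> is bounded away from 0, and \<open>\<rho> \<le> C1 * L\<close> passes
        this on to \<open>L\<close>.\<close>
      case True
      have "0 \<le> (k - 1) * (q / (1600 * (real n + \<nu>)\<^sup>2))" using k q by simp
      then have "0 \<le> \<nu> * (2 * ln \<rho> - ln \<epsilon>)" using le True by simp
      then have "0 \<le> 2 * ln \<rho> - ln \<epsilon>" using nu by (simp add: zero_le_mult_iff)
      moreover have "\<bar>C2\<bar> * L \<le> \<bar>C2\<bar>" using True Lnn by (simp add: mult_left_le)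
      ultimately have "- \<bar>C2\<bar> / 2 \<le> ln \<rho>" using le_eps by linarith
      then have "exp (- \<bar>C2\<bar> / 2) \<le> \<rho>" using rho by (simp add: ln_ge_iff)
      also have "\<rho> \<le> (\<bar>C1\<bar> + 1) * L" using rhoL L C1 by (simp add: distrib_right)
      finally have "exp (- \<bar>C2\<bar> / 2) / (\<bar>C1\<bar> + 1) \<le> L"
        by (simp add: pos_divide_le_eq mult.commute)
      then show ?thesis by (simp add: L0_def)
    qed
    define M where "M = \<nu> * (real n + \<nu>)\<^sup>2"
    have "1 \<le> (real n + \<nu>)\<^sup>2" using nu by (intro one_le_power) simp
    then have M: "1 \<le> M" using nu mult_mono[of 1 \<nu> 1 "(real n + \<nu>)\<^sup>2"] by (simp add: M_def)
    \<comment> \<open>Accounts for the one iteration that \<open>k - 1\<close> omits.\<close>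
    have "1 \<le> M * (L / L0)"
      using M \<open>L0 \<le> L\<close> L0 mult_mono[of 1 M 1 "L / L0"] by simp
    then have 1: "1 \<le> 1 / L0 * (M * L)" by simp
    have "ln \<rho> \<le> \<bar>C1\<bar> * L"
      using ln_le_minus_one[OF rho] rhoL C1 by simp
    then have "ln n + 2 * ln \<rho> - ln \<epsilon> \<le> (1 + 2 * \<bar>C1\<bar> + \<bar>C2\<bar>) * L"
      using nL le_eps by (simp add: distrib_right)
    then have "\<nu> * (ln n + 2 * ln \<rho> - ln \<epsilon>) \<le> \<nu> * ((1 + 2 * \<bar>C1\<bar> + \<bar>C2\<bar>) * L)"
      using nu by (intro mult_left_mono) auto
    with le have "(k - 1) * (q / (1600 * (real n + \<nu>)\<^sup>2)) \<le> \<nu> * ((1 + 2 * \<bar>C1\<bar> + \<bar>C2\<bar>) * L)"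
      by linarith
    moreover have "0 < q / (1600 * (real n + \<nu>)\<^sup>2)" using q nu by simp
    ultimately have "k - 1 \<le> \<nu> * ((1 + 2 * \<bar>C1\<bar> + \<bar>C2\<bar>) * L) / (q / (1600 * (real n + \<nu>)\<^sup>2))"
      by (simp only: pos_le_divide_eq)
    also have "\<dots> = 1600 / q * (1 + 2 * \<bar>C1\<bar> + \<bar>C2\<bar>) * (M * L)"
      by (simp add: M_def mult_ac)
    finally have "k \<le> C * (M * L)" using 1 unfolding C_def distrib_right by linarith
    then show ?thesis by (simp only: M_def)
  qed
  then show ?thesis using C unfolding q_def by blast
qed

theorem theorem2:
  fixes \<kappa> C1 C2 :: real
  assumes "0 \<le> \<kappa>" and "\<kappa> < 1"
  shows "\<exists>C::real. \<forall>(m::nat) (n::nat) (A::real mat) (b::real vec) (c::real vec)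
      (\<rho>::real) (\<epsilon>::real) (\<nu>::real) (L::real) (s::nat \<Rightarrow> config).
    0 < n \<longrightarrow>
    A \<in> carrier_mat m n \<longrightarrow> vec_space.rank m A = m \<longrightarrow>
    b \<in> carrier_vec m \<longrightarrow> c \<in> carrier_vec n \<longrightarrow>
    0 < \<rho> \<longrightarrow> 0 < \<epsilon> \<longrightarrow> sqrt (real n) \<le> \<nu> \<longrightarrow> \<nu> \<le> 2 * real n \<longrightarrow>
    ln (real n) \<le> L \<longrightarrow> \<rho> \<le> C1 * L \<longrightarrow> ln (1 / \<epsilon>) \<le> C2 * L \<longrightarrow>
    complete_run A b c \<rho> \<epsilon> \<nu> \<kappa> s \<longrightarrow>
    (\<exists>t k x y z. real k \<le> C * (\<nu> * (real n + \<nu>)\<^sup>2 * L) \<and>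
       (s t = StoppedInStep1 k x y z \<and> approximate_solution A b c \<rho> \<epsilon> x y z \<or>
        s t = StoppedInStep3 k x y z \<and>
        \<not> (\<exists>x' y' z'. primal_optimal A b c x' \<and> dual_optimal A b c y' z' \<and>
                      max_norm (x' @\<^sub>v z') \<le> \<rho>)))"
proof -
  obtain C where C0: "0 \<le> C" and C: "\<And>n \<rho> \<epsilon> \<nu> L k. 1 \<le> (n::nat) \<Longrightarrow> 0 < \<rho> \<Longrightarrow> 0 < \<epsilon> \<Longrightarrow> 1 \<le> \<nu> \<Longrightarrow>
    ln (real n) \<le> L \<Longrightarrow> \<rho> \<le> C1 * L \<Longrightarrow> ln (1 / \<epsilon>) \<le> C2 * L \<Longrightarrow> 1 \<le> k \<Longrightarrow>
    (k - 1) * ((1 - \<kappa>) ^ 4 / (1600 * (real n + \<nu>)\<^sup>2)) \<le> \<nu> * (ln n + 2 * ln \<rho> - ln \<epsilon>) \<Longrightarrow>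
    k \<le> C * (\<nu> * (real n + \<nu>)\<^sup>2 * L)"
    using iteration_count_le[OF assms(2), of C1 C2] by blast
  show ?thesis
  proof (intro exI[of _ C] allI impI)
    fix m n :: nat and A :: rmat and b c :: rvec and \<rho> \<epsilon> \<nu> L :: real and s :: "nat \<Rightarrow> config"
    assume h: "0 < n" "A \<in> carrier_mat m n" "vec_space.rank m A = m" "b \<in> carrier_vec m"
      "c \<in> carrier_vec n" "0 < \<rho>" "0 < \<epsilon>" "sqrt (real n) \<le> \<nu>" "\<nu> \<le> 2 * real n"
      and L: "ln (real n) \<le> L" "\<rho> \<le> C1 * L" "ln (1 / \<epsilon>) \<le> C2 * L"
      and run: "complete_run A b c \<rho> \<epsilon> \<nu> \<kappa> s"
    interpret potential_reduction m n A b c \<rho> \<epsilon> \<nu> \<kappa>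
      by unfold_locales (use h assms in auto)
    obtain t k x y z where it: "iterate k x y z" and stop:
      "s t = StoppedInStep1 k x y z \<and> approximate_solution A b c \<rho> \<epsilon> x y z \<or>
       s t = StoppedInStep3 k x y z \<and>
       \<not> (\<exists>x' y' z'. primal_optimal A b c x' \<and> dual_optimal A b c y' z' \<and> max_norm (x' @\<^sub>v z') \<le> \<rho>)"
      using complete_run_stops[OF run] by blast
    have "0 \<le> ln (real n)" using h(1) by simp
    then have L_nonneg: "0 \<le> L" using L(1) by linarith
    have "real k \<le> C * (\<nu> * (real n + \<nu>)\<^sup>2 * L)"
    \<comment> \<open>A run that stops before the first update says nothing about the potential; the
      bound then rests on \<open>C \<ge> 0\<close> and \<open>L \<ge> 0\<close>.\<close>
    proof (cases "k = 0")
      case True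
      then show ?thesis using C0 nu_ge_1 L_nonneg by simp
    next
      case False
      then have "(real k - 1) * \<delta> \<le> \<nu> * (ln n + 2 * ln \<rho> - ln \<epsilon>)"
        using it unfolding iterate_def by blast
      then show ?thesis
        using False h L nu_ge_1 by (intro C[of n \<rho> \<epsilon>]) (simp_all add: \<delta>_def)
    qed
    then show "\<exists>t k x y z. real k \<le> C * (\<nu> * (real n + \<nu>)\<^sup>2 * L) \<and>
       (s t = StoppedInStep1 k x y z \<and> approximate_solution A b c \<rho> \<epsilon> x y z \<or>
        s t = StoppedInStep3 k x y z \<and>
        \<not> (\<exists>x' y' z'. primal_optimal A b c x' \<and> dual_optimal A b c y' z' \<and>
                      max_norm (x' @\<^sub>v z') \<le> \<rho>))"
      using stop by blast
  qed
qed

end
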